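(* The semigroups $RC$ and $RW$ of right-infinite products of non-degenerate curls and of non-degenerate whirls are right limit semigroups. The semigroups $LC$ and $LW$ of left-infinite products of non-degenerate curls and of non-degenerate whirls are left limit semigroups.
   Context: Fix $n\ge1$. All matrices are doubly infinite real matrices $X=(x_{i,j})_{i,j\in\mathbb{Z}}$ with $x_{i+n,j+n}=x_{i,j}$, upper triangular with $1$'s on the diagonal; $U$ denotes the group of all such matrices. The whirl $M(a_1,\dots,a_n)$ has $m_{i,i}=1$, $m_{i,i+1}=a_i$ (index modulo $n$), other entries $0$. The curl $N(a_1,\dots,a_n)$ has $1$'s on the diagonal, $(i,j)$ entry $a_ia_{i+1}\cdots a_{j-1}$ for $i<j$ (indices modulo $n$), and $0$ below the diagonal. A whirl or curl is non-degenerate if all its parameters are strictly positive. Limits of matrices are entrywise; $\prod_{i=1}^\infty X^{(i)}=\lim_{k\to\infty}X^{(1)}\cdots X^{(k)}$ and $\prod_{i=-\infty}^{-1}X^{(i)}=\lim_{k\to-\infty}X^{(k)}X^{(k+1)}\cdots X^{(-1)}$. $RC$ (resp. $RW$) is the set of all matrices $\prod_{i=1}^\infty N(a^{(i)}_1,\dots,a^{(i)}_n)$ (resp. $\prod_{i=1}^\infty M(a^{(i)}_1,\dots,a^{(i)}_n)$) with all $a^{(i)}_j>0$ and $\sum_{i,j}a^{(i)}_j<\infty$. $LC$ (resp. $LW$) is the set of all matrices $\prod_{i=-\infty}^{-1} N(a^{(i)}_1,\dots,a^{(i)}_n)$ (resp. $\prod_{i=-\infty}^{-1} M(a^{(i)}_1,\dots,a^{(i)}_n)$)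 with all $a^{(i)}_j>0$ and $\sum_{i,j}a^{(i)}_j<\infty$. A subsemigroup $\Sigma\subset U$ is a right limit semigroup if for all $X^{(1)},X^{(2)},\ldots\in \Sigma$ such that $X=\prod_{i=1}^\infty X^{(i)}$ exists, one has $X\in \Sigma$. It is a left limit semigroup if for all $\ldots,X^{(-2)},X^{(-1)}\in \Sigma$ such that $X=\prod_{i=-\infty}^{-1}X^{(i)}$ exists, one has $X\in \Sigma$. *)

theory Defs
  imports Complex_Main "HOL-Library.Groups_Big_Fun"
begin

text \<open>Doubly infinite real matrices, rows and columns indexed by the integers.\<close>

type_synonym dimat = "int \<Rightarrow> int \<Rightarrow> real"

definition dimat_one :: dimat where
  "dimat_one = (\<lambda>i j. if i = j then 1 else 0)"

text \<open>The sum is \<^const>\<open>Sum_any\<close>, the sum over all integers \<open>k\<close> of a finitely supported family;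
  for upper triangular matrices only \<open>i \<le> k \<le> j\<close> contributes, see \<open>dimat_mult_upper_triangular\<close>.\<close>

definition dimat_mult :: "dimat \<Rightarrow> dimat \<Rightarrow> dimat"  (infixl \<open>**\<^sub>\<int>\<close> 70) where
  "X **\<^sub>\<int> Y = (\<lambda>i j. Sum_any (\<lambda>k. X i k * Y k j))"

definition U :: "nat \<Rightarrow> dimat set" where
  "U n = {X. (\<forall>i j. X (i + int n) (j + int n) = X i j) \<and>
             (\<forall>i j. j < i \<longrightarrow> X i j = 0) \<and>
             (\<forall>i. X i i = 1)}"

text \<open>The parameters \<open>a\<^sub>1, \<dots>, a\<^sub>n\<close>, indexed modulo \<open>n\<close>, are given by the values of \<open>a\<close> at the
  residues \<open>0, \<dots>, n - 1\<close>, with \<open>a\<^sub>n\<close> sitting at residue \<open>0\<close>; other values of \<open>a\<close> are irrelevant.\<close>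

definition whirl :: "nat \<Rightarrow> (int \<Rightarrow> real) \<Rightarrow> dimat" where
  "whirl n a = (\<lambda>i j. if j = i then 1 else if j = i + 1 then a (i mod int n) else 0)"

definition curl :: "nat \<Rightarrow> (int \<Rightarrow> real) \<Rightarrow> dimat" where
  "curl n a = (\<lambda>i j. if j = i then 1
                     else if i < j then (\<Prod>k\<in>{i..<j}. a (k mod int n)) else 0)"

definition dimat_lim :: "(nat \<Rightarrow> dimat) \<Rightarrow> dimat \<Rightarrow> bool" where
  "dimat_lim P X \<longleftrightarrow> (\<forall>i j. (\<lambda>k. P k i j) \<longlonglongrightarrow> X i j)"

text \<open>Right-infinite products: the factor \<open>X k\<close> is \<open>X\<^bsup>(k+1)\<^esup>\<close>, so that \<open>right_partial X k\<close> is
  \<open>X\<^bsup>(1)\<^esup> \<cdots> X\<^bsup>(k)\<^esup>\<close>.\<close>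

primrec right_partial :: "(nat \<Rightarrow> dimat) \<Rightarrow> nat \<Rightarrow> dimat" where
  "right_partial X 0 = dimat_one"
| "right_partial X (Suc k) = right_partial X k **\<^sub>\<int> X k"

text \<open>Left-infinite products: the factor \<open>X k\<close> is \<open>X\<^bsup>(-(k+1))\<^esup>\<close>, so that \<open>left_partial X k\<close> is
  \<open>X\<^bsup>(-k)\<^esup> \<cdots> X\<^bsup>(-1)\<^esup>\<close>.\<close>

primrec left_partial :: "(nat \<Rightarrow> dimat) \<Rightarrow> nat \<Rightarrow> dimat" where
  "left_partial X 0 = dimat_one"
| "left_partial X (Suc k) = X k **\<^sub>\<int> left_partial X k"

definition has_right_prod :: "(nat \<Rightarrow> dimat) \<Rightarrow> dimat \<Rightarrow> bool" where
  "has_right_prod X L \<longleftrightarrow> dimat_lim (right_partial X) L"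

definition has_left_prod :: "(nat \<Rightarrow> dimat) \<Rightarrow> dimat \<Rightarrow> bool" where
  "has_left_prod X L \<longleftrightarrow> dimat_lim (left_partial X) L"

text \<open>Families of non-degenerate parameters \<open>a\<^sup>(\<^sup>i\<^sup>)\<^sub>j\<close> with finite total sum; for positive
  terms the double sum may be taken as an iterated one.\<close>

definition admissible :: "nat \<Rightarrow> (nat \<Rightarrow> int \<Rightarrow> real) \<Rightarrow> bool" where
  "admissible n a \<longleftrightarrow> (\<forall>i. \<forall>j\<in>{0..<int n}. 0 < a i j) \<and>
                     summable (\<lambda>i. \<Sum>j\<in>{0..<int n}. a i j)"

definition RC :: "nat \<Rightarrow> dimat set" where
  "RC n = {X. \<exists>a. admissible n a \<and> has_right_prod (\<lambda>i. curl n (a i)) X}"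

definition RW :: "nat \<Rightarrow> dimat set" where
  "RW n = {X. \<exists>a. admissible n a \<and> has_right_prod (\<lambda>i. whirl n (a i)) X}"

definition LC :: "nat \<Rightarrow> dimat set" where
  "LC n = {X. \<exists>a. admissible n a \<and> has_left_prod (\<lambda>i. curl n (a i)) X}"

definition LW :: "nat \<Rightarrow> dimat set" where
  "LW n = {X. \<exists>a. admissible n a \<and> has_left_prod (\<lambda>i. whirl n (a i)) X}"

definition subsemigroup_U :: "nat \<Rightarrow> dimat set \<Rightarrow> bool" where
  "subsemigroup_U n S \<longleftrightarrow> S \<subseteq> U n \<and> (\<forall>X\<in>S. \<forall>Y\<in>S. X **\<^sub>\<int> Y \<in> S)"

definition right_limit_semigroup :: "nat \<Rightarrow> dimat set \<Rightarrow> bool" where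
  "right_limit_semigroup n S \<longleftrightarrow> subsemigroup_U n S \<and>
     (\<forall>X L. (\<forall>k. X k \<in> S) \<longrightarrow> has_right_prod X L \<longrightarrow> L \<in> S)"

definition left_limit_semigroup :: "nat \<Rightarrow> dimat set \<Rightarrow> bool" where
  "left_limit_semigroup n S \<longleftrightarrow> subsemigroup_U n S \<and>
     (\<forall>X L. (\<forall>k. X k \<in> S) \<longrightarrow> has_left_prod X L \<longrightarrow> L \<in> S)"

lemma dimat_mult_upper_triangular:
  assumes "\<And>i j. j < i \<Longrightarrow> X i j = 0" and "\<And>i j. j < i \<Longrightarrow> Y i j = 0"
  shows "(X **\<^sub>\<int> Y) i j = (\<Sum>k\<in>{i..j}. X i k * Y k j)"
  unfolding dimat_mult_def
proof (rule Sum_any.expand_superset)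
  show "finite {i..j}" by simp
  show "{k. X i k * Y k j \<noteq> 0} \<subseteq> {i..j}"
    using assms by (auto simp: not_less[symmetric])
qed

end

theory Submission imports Defs begin

text \<open>A limit of products of right-infinite products is, a priori, a product of order type
  \<open>\<omega>\<^sup>2\<close>; the point is that it can be rewritten as one of order type \<open>\<omega>\<close>. Everything rests on
  moving one factor to the left past infinitely many others. Let \<open>F\<close> stand for whirls or for
  curls. If \<open>X = F(a\<^sup>0) F(a\<^sup>1) \<cdots>\<close> and \<open>b\<close> is a positive parameter vector, then \<open>X F(b)\<close> is again such
  a product (\<open>RP_mult_factor\<close>). Splitting off finitely many factors of \<open>X\<close>, one may assume that the
  remaining \<open>a\<^sup>k\<close> are small compared with \<open>b\<close>. Then there are positive vectors \<open>b\<^sup>k \<longlonglongrightarrow> b\<close> and \<open>c\<^sup>k\<close>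
  with \<open>F(a\<^sup>k) F(b\<^bsup>k+1\<^esup>) = F(b\<^sup>k) F(c\<^sup>k)\<close>, whence
  \<open>F(a\<^sup>0) \<cdots> F(a\<^bsup>k-1\<^esup>) F(b\<^sup>k) = F(b\<^sup>0) F(c\<^sup>0) \<cdots> F(c\<^bsup>k-1\<^esup>)\<close>, and letting \<open>k\<close> grow turns
  \<open>X F(b)\<close> into \<open>F(b\<^sup>0) F(c\<^sup>0) F(c\<^sup>1) \<cdots>\<close>.

  The vectors \<open>b\<^sup>k\<close> come from a linear problem (\<open>scalar_exchange\<close>). A whirl \<open>M(b)\<close> has a left null
  vector, with entries of alternating sign and absolute values \<open>p\<close> such that \<open>p\<^bsub>i+1\<^esub> = b\<^sub>i p\<^sub>i\<close>, and
  the exchange relation says that the null vector of \<open>M(b\<^sup>k)\<close> is carried by \<open>M(a\<^sup>k)\<close> to the null vector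
  of \<open>M(b\<^bsup>k+1\<^esup>)\<close>. Solving this backwards from \<open>k = \<infinity>\<close> gives a series with positive terms, which
  converges because the \<open>a\<^sup>k\<close> are small. Curls are the inverses of whirls up to signs, so their
  exchange relation is that of whirls read in the opposite direction.

  Given this, the limit \<open>L\<close> of \<open>P\<^sub>0, P\<^sub>1 = P\<^sub>0 Y\<^sub>0, P\<^sub>2 = P\<^sub>1 Y\<^sub>1, \<dots>\<close> is an infinite product as soon as
  right multiplication by every \<open>Y\<^sub>m\<close> preserves infinite products (\<open>RP_closed\<close>): factorizations of
  the \<open>P\<^sub>m\<close> are chosen so that each keeps an ever longer initial part of the previous one and leaves a
  tail of mass at most \<open>1/(m+1)\<close>; then the initial parts alone already converge to \<open>L\<close>. With
  \<open>Y\<^sub>m\<close> running through single factors this yields closure under products, and with \<open>Y\<^sub>m\<close> running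
  through infinite products it yields closure under limits.

  The statements for left-infinite products follow by the reflection
  \<open>x\<^bsub>i,j\<^esub> \<mapsto> x\<^bsub>-j,-i\<^esub>\<close>, an anti-automorphism that preserves whirls and curls.\<close>

section \<open>Multiplication and limits of periodic unitriangular matrices\<close>

lemma dimat_mult_U:
  assumes "X \<in> U n" and "Y \<in> U n"
  shows "(X **\<^sub>\<int> Y) i j = (\<Sum>k\<in>{i..j}. X i k * Y k j)"
  using assms by (intro dimat_mult_upper_triangular) (auto simp: U_def)

lemma dimat_mult_U_superset:
  assumes "X \<in> U n" and "Y \<in> U n" and "finite S" and "{i..j} \<subseteq> S"
  shows "(X **\<^sub>\<int> Y) i j = (\<Sum>k\<in>S. X i k * Y k j)"
  unfolding dimat_mult_U[OF assms(1,2)]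
  using assms by (intro sum.mono_neutral_left) (auto simp: U_def not_le)

lemma U_one: "dimat_one \<in> U n"
  by (simp add: U_def dimat_one_def)

lemma U_mult:
  assumes X: "X \<in> U n" and Y: "Y \<in> U n"
  shows "X **\<^sub>\<int> Y \<in> U n"
proof -
  have "(X **\<^sub>\<int> Y) (i + int n) (j + int n) = (X **\<^sub>\<int> Y) i j" for i j
    unfolding dimat_mult_U[OF X Y]
  proof (rule sum.reindex_bij_witness[of _ "\<lambda>k. k + int n" "\<lambda>k. k - int n"])
    fix k
    have "X (i + int n) ((k - int n) + int n) = X i (k - int n)"
      and "Y ((k - int n) + int n) (j + int n) = Y (k - int n) j"
      using X Y unfolding U_def by blast+
    then show "X i (k - int n) * Y (k - int n) j = X (i + int n) k * Y k (j + int n)"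
      by simp
  qed auto
  moreover have "(X **\<^sub>\<int> Y) i j = 0" if "j < i" for i j
    using that by (simp add: dimat_mult_U[OF X Y])
  moreover have "(X **\<^sub>\<int> Y) i i = 1" for i
    using X Y by (simp add: dimat_mult_U[OF X Y] U_def)
  ultimately show ?thesis by (simp add: U_def)
qed

lemma dimat_one_mult: "X \<in> U n \<Longrightarrow> dimat_one **\<^sub>\<int> X = X"
proof (intro ext)
  fix i j assume X: "X \<in> U n"
  have "(dimat_one **\<^sub>\<int> X) i j = (\<Sum>k\<in>insert i {i..j}. dimat_one i k * X k j)"
    by (rule dimat_mult_U_superset[OF U_one X]) auto
  also have "\<dots> = (\<Sum>k\<in>insert i {i..j}. if k = i then X i j else 0)"
    by (rule sum.cong) (auto simp: dimat_one_def)
  also have "\<dots> = X i j" by (subst sum.delta) auto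
  finally show "(dimat_one **\<^sub>\<int> X) i j = X i j" .
qed

lemma dimat_mult_one: "X \<in> U n \<Longrightarrow> X **\<^sub>\<int> dimat_one = X"
proof (intro ext)
  fix i j assume X: "X \<in> U n"
  have "(X **\<^sub>\<int> dimat_one) i j = (\<Sum>k\<in>insert j {i..j}. X i k * dimat_one k j)"
    by (rule dimat_mult_U_superset[OF X U_one]) auto
  also have "\<dots> = (\<Sum>k\<in>insert j {i..j}. if k = j then X i j else 0)"
    by (rule sum.cong) (auto simp: dimat_one_def)
  also have "\<dots> = X i j" by (subst sum.delta) auto
  finally show "(X **\<^sub>\<int> dimat_one) i j = X i j" .
qed

lemma dimat_mult_assoc:
  assumes X: "X \<in> U n" and Y: "Y \<in> U n" and Z: "Z \<in> U n"
  shows "(X **\<^sub>\<int> Y) **\<^sub>\<int> Z = X **\<^sub>\<int> (Y **\<^sub>\<int> Z)"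
proof (intro ext)
  fix i j
  have "((X **\<^sub>\<int> Y) **\<^sub>\<int> Z) i j = (\<Sum>k\<in>{i..j}. (\<Sum>l\<in>{i..j}. X i l * Y l k) * Z k j)"
    unfolding dimat_mult_U[OF U_mult[OF X Y] Z]
    by (intro sum.cong refl) (simp add: dimat_mult_U_superset[OF X Y, of "{i..j}"])
  also have "\<dots> = (\<Sum>k\<in>{i..j}. \<Sum>l\<in>{i..j}. X i l * (Y l k * Z k j))"
    by (simp add: sum_distrib_right mult.assoc)
  also have "\<dots> = (\<Sum>l\<in>{i..j}. \<Sum>k\<in>{i..j}. X i l * (Y l k * Z k j))"
    by (rule sum.swap)
  also have "\<dots> = (\<Sum>l\<in>{i..j}. X i l * (\<Sum>k\<in>{i..j}. Y l k * Z k j))"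
    by (simp add: sum_distrib_left)
  also have "\<dots> = (X **\<^sub>\<int> (Y **\<^sub>\<int> Z)) i j"
    unfolding dimat_mult_U[OF X U_mult[OF Y Z]]
    by (intro sum.cong refl) (simp add: dimat_mult_U_superset[OF Y Z, of "{i..j}"])
  finally show "((X **\<^sub>\<int> Y) **\<^sub>\<int> Z) i j = (X **\<^sub>\<int> (Y **\<^sub>\<int> Z)) i j" .
qed

lemma dimat_mult_superdiagonal:
  assumes "X \<in> U n" and "Y \<in> U n"
  shows "(X **\<^sub>\<int> Y) i (i + 1) = X i (i + 1) + Y i (i + 1)"
proof -
  have "{i..i+1} = {i, i + 1}" by auto
  then show ?thesis using assms by (simp add: dimat_mult_U[OF assms] U_def)
qed

lemma dimat_lim_unique: "dimat_lim P X \<Longrightarrow> dimat_lim P Y \<Longrightarrow> X = Y"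
  unfolding dimat_lim_def by (intro ext) (blast intro: LIMSEQ_unique)

lemma U_lim:
  assumes "\<And>k. P k \<in> U n" and "dimat_lim P X"
  shows "X \<in> U n"
proof -
  have *: "X i j = c" if "\<And>k. P k i j = c" for i j c
  proof -
    have "(\<lambda>k. P k i j) \<longlonglongrightarrow> X i j" using assms(2) by (simp add: dimat_lim_def)
    then show ?thesis by (simp add: that LIMSEQ_const_iff)
  qed
  have "X (i + int n) (j + int n) = X i j" for i j
  proof -
    have "(\<lambda>k. P k (i + int n) (j + int n)) = (\<lambda>k. P k i j)"
      using assms(1) by (auto simp: U_def)
    then show ?thesis
      using assms(2) unfolding dimat_lim_def by (metis LIMSEQ_unique)
  qed
  moreover have "X i j = 0" if "j < i" for i j using assms(1) that by (intro *) (auto simp: U_def)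
  moreover have "X i i = 1" for i using assms(1) by (intro *) (auto simp: U_def)
  ultimately show ?thesis by (auto simp: U_def)
qed

lemma dimat_lim_mult:
  assumes "\<And>k. P k \<in> U n" "\<And>k. Q k \<in> U n" "dimat_lim P X" "dimat_lim Q Y"
  shows "dimat_lim (\<lambda>k. P k **\<^sub>\<int> Q k) (X **\<^sub>\<int> Y)"
proof -
  have X: "X \<in> U n" and Y: "Y \<in> U n" using U_lim assms by blast+
  show ?thesis
    using assms(3,4) unfolding dimat_lim_def dimat_mult_U[OF assms(1,2)] dimat_mult_U[OF X Y]
    by (intro allI tendsto_sum tendsto_mult) auto
qed

lemma dimat_lim_const: "dimat_lim (\<lambda>k. X) X"
  by (simp add: dimat_lim_def)

lemma right_partial_U: "(\<And>k. X k \<in> U n) \<Longrightarrow> right_partial X k \<in> U n"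
  by (induction k) (auto simp: U_one U_mult)

lemma right_partial_add:
  assumes "\<And>k. X k \<in> U n"
  shows "right_partial X (l + k) = right_partial X l **\<^sub>\<int> right_partial (\<lambda>i. X (l + i)) k"
proof (induction k)
  case 0
  show ?case using dimat_mult_one[OF right_partial_U[of X, OF assms]] by simp
next
  case (Suc k)
  then show ?case
    using dimat_mult_assoc[OF right_partial_U[of X, OF assms]
        right_partial_U[of "\<lambda>i. X (l + i)", OF assms] assms] by simp
qed

lemma right_partial_cong:
  "(\<And>i. i < k \<Longrightarrow> X i = Y i) \<Longrightarrow> right_partial X k = right_partial Y k"
  by (induction k) auto

lemma right_partial_superdiagonal:
  assumes "\<And>k. X k \<in> U n"
  shows "right_partial X k i (i + 1) = (\<Sum>m<k. X m i (i + 1))"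
  by (induction k)
    (auto simp: dimat_one_def dimat_mult_superdiagonal[OF right_partial_U[of X, OF assms] assms])

section \<open>Bounding entries by the mass of the factors\<close>

text \<open>The bound \<open>s\<^bsup>j-i\<^esup>\<close> on the entries is chosen because it is additive in \<open>s\<close> under multiplication:
  products of factors with total mass \<open>s\<close> are dominated by \<open>s\<close>, which gives convergence of the
  products and shows that a tail of small mass is close to the identity.\<close>

definition dominated :: "real \<Rightarrow> dimat \<Rightarrow> bool" where
  "dominated s X \<longleftrightarrow> 0 \<le> s \<and> (\<forall>i j. 0 \<le> X i j \<and> (i \<le> j \<longrightarrow> X i j \<le> s ^ nat (j - i)))"

lemma dominated_one: "dominated 0 dimat_one"
  by (auto simp: dominated_def dimat_one_def)

text \<open>The left-hand side is the binomial expansion with every coefficient lowered to \<open>1\<close>.\<close>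

lemma sum_powers_le_power_add:
  fixes s t :: real
  assumes "0 \<le> s" "0 \<le> t"
  shows "(\<Sum>k\<le>d. s ^ k * t ^ (d - k)) \<le> (s + t) ^ d"
proof -
  have "(\<Sum>k\<le>d. s ^ k * t ^ (d - k)) \<le> (\<Sum>k\<le>d. of_nat (d choose k) * s ^ k * t ^ (d - k))"
  proof (rule sum_mono)
    fix k assume "k \<in> {..d}"
    then have "1 \<le> d choose k" by (simp add: Suc_leI)
    then have "(1::real) \<le> of_nat (d choose k)" by (metis of_nat_1 of_nat_le_iff)
    then have "1 * (s ^ k * t ^ (d - k)) \<le> of_nat (d choose k) * (s ^ k * t ^ (d - k))"
      using assms by (intro mult_right_mono) auto
    then show "s ^ k * t ^ (d - k) \<le> of_nat (d choose k) * s ^ k * t ^ (d - k)"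
      by (simp add: mult.assoc)
  qed
  then show ?thesis by (simp add: binomial_ring)
qed

lemma dominated_mult:
  assumes X: "X \<in> U n" "dominated s X" and Y: "Y \<in> U n" "dominated t Y"
  shows "dominated (s + t) (X **\<^sub>\<int> Y)"
proof -
  have st: "0 \<le> s" "0 \<le> t" using X Y by (auto simp: dominated_def)
  have "0 \<le> (X **\<^sub>\<int> Y) i j" for i j
    unfolding dimat_mult_U[OF X(1) Y(1)] using X Y by (auto simp: dominated_def intro!: sum_nonneg)
  moreover have "(X **\<^sub>\<int> Y) i j \<le> (s + t) ^ nat (j - i)" if "i \<le> j" for i j
  proof -
    have nat_diff: "nat (j - i) - nat (k - i) = nat (j - k)" if "i \<le> k" for k
      using that by arith
    have "(X **\<^sub>\<int> Y) i j \<le> (\<Sum>k\<in>{i..j}. s ^ nat (k - i) * t ^ nat (j - k))"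
      unfolding dimat_mult_U[OF X(1) Y(1)] using X Y st
      by (intro sum_mono mult_mono) (auto simp: dominated_def)
    also have "\<dots> = (\<Sum>k\<le>nat (j - i). s ^ k * t ^ (nat (j - i) - k))"
      by (rule sum.reindex_bij_witness[of _ "\<lambda>k. i + int k" "\<lambda>k. nat (k - i)"])
         (use that in \<open>auto simp: nat_diff le_nat_iff\<close>)
    also have "\<dots> \<le> (s + t) ^ nat (j - i)" using st by (rule sum_powers_le_power_add)
    finally show ?thesis .
  qed
  ultimately show ?thesis using st by (auto simp: dominated_def)
qed

lemma dominated_mono: "dominated s X \<Longrightarrow> s \<le> t \<Longrightarrow> dominated t X"
  unfolding dominated_def by (meson order_trans power_mono)

lemma dominated_lim:
  assumes "\<And>k. dominated s (P k)" and "dimat_lim P X"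
  shows "dominated s X"
  using assms unfolding dominated_def dimat_lim_def
  by (meson LIMSEQ_le_const LIMSEQ_le_const2)

lemma entry_le_mult:
  assumes X: "X \<in> U n" and Y: "Y \<in> U n" and nn: "\<And>i j. 0 \<le> X i j" "\<And>i j. 0 \<le> Y i j"
  shows "X i j \<le> (X **\<^sub>\<int> Y) i j"
proof (cases "i \<le> j")
  case True
  have "X i j * Y j j \<le> (\<Sum>k\<in>{i..j}. X i k * Y k j)"
    using nn True by (intro member_le_sum) auto
  then show ?thesis using Y by (simp add: dimat_mult_U[OF X Y] U_def)
next
  case False
  then show ?thesis using X U_mult[OF X Y] by (simp add: U_def)
qed

text \<open>Factors \<open>T m\<close> tending to the identity can be dropped from a limit. Since
  \<open>T m\<close> has nonnegative entries and unit diagonal, \<open>C m\<close> is bounded entrywise by the convergent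
  product, hence the error made by dropping \<open>T m\<close> tends to zero.\<close>

lemma dimat_lim_cancel_right:
  assumes C: "\<And>m. C m \<in> U n" "\<And>m i j. 0 \<le> C m i j"
    and T: "\<And>m. T m \<in> U n" "\<And>m. dominated (e m) (T m)" and e: "e \<longlonglongrightarrow> 0"
    and lim: "dimat_lim (\<lambda>m. C m **\<^sub>\<int> T m) L"
  shows "dimat_lim C L"
  unfolding dimat_lim_def
proof (intro allI)
  fix i j
  have L: "(\<lambda>m. (C m **\<^sub>\<int> T m) i k) \<longlonglongrightarrow> L i k" for k
    using lim by (simp add: dimat_lim_def)
  show "(\<lambda>m. C m i j) \<longlonglongrightarrow> L i j"
  proof (cases "i \<le> j")
    case False
    then have "C m i j = 0" for m using C by (simp add: U_def)
    moreover have "(C m **\<^sub>\<int> T m) i j = 0" for m using False U_mult[OF C(1) T(1)] by (simp add: U_def)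
    ultimately show ?thesis using L[of j] by simp
  next
    case True
    have Tnn: "0 \<le> T m k l" for m k l using T(2)[of m] by (simp add: dominated_def)
    have small: "(\<lambda>m. C m i k * T m k j) \<longlonglongrightarrow> 0" if k: "k \<in> {i..<j}" for k
    proof (rule tendsto_sandwich[OF _ _ tendsto_const])
      show "eventually (\<lambda>m. 0 \<le> C m i k * T m k j) sequentially"
        using C Tnn by simp
      show "eventually (\<lambda>m. C m i k * T m k j \<le> (C m **\<^sub>\<int> T m) i k * e m ^ nat (j - k)) sequentially"
      proof (intro always_eventually allI mult_mono)
        fix m
        show "C m i k \<le> (C m **\<^sub>\<int> T m) i k" by (rule entry_le_mult[OF C(1) T(1) C(2) Tnn])
        then show "0 \<le> (C m **\<^sub>\<int> T m) i k" using C(2)[of m i k] by linarith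
        show "T m k j \<le> e m ^ nat (j - k)" using T(2)[of m] k by (simp add: dominated_def)
      qed (rule Tnn)
      have "(\<lambda>m. (C m **\<^sub>\<int> T m) i k * e m ^ nat (j - k)) \<longlonglongrightarrow> L i k * 0 ^ nat (j - k)"
        using L e by (intro tendsto_mult tendsto_power)
      then show "(\<lambda>m. (C m **\<^sub>\<int> T m) i k * e m ^ nat (j - k)) \<longlonglongrightarrow> 0"
        using k by (simp add: power_0_left)
    qed
    have cols: "{i..j} = insert j {i..<j}" using True by auto
    have "C m i j = (C m **\<^sub>\<int> T m) i j - (\<Sum>k\<in>{i..<j}. C m i k * T m k j)" for m
      unfolding dimat_mult_U[OF C(1) T(1)] cols using T(1)[of m] by (simp add: U_def)
    moreover have "(\<lambda>m. (C m **\<^sub>\<int> T m) i j - (\<Sum>k\<in>{i..<j}. C m i k * T m k j)) \<longlonglongrightarrow> L i j - (\<Sum>k\<in>{i..<j}. 0)"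
      by (intro tendsto_diff L tendsto_sum small)
    ultimately show ?thesis by simp
  qed
qed

section \<open>Closure of infinite products under limits\<close>

abbreviation positive :: "nat \<Rightarrow> (int \<Rightarrow> real) \<Rightarrow> bool" where
  "positive n a \<equiv> \<forall>j\<in>{0..<int n}. 0 < a j"

abbreviation mass :: "nat \<Rightarrow> (int \<Rightarrow> real) \<Rightarrow> real" where
  "mass n a \<equiv> \<Sum>j\<in>{0..<int n}. a j"

abbreviation total :: "nat \<Rightarrow> (nat \<Rightarrow> int \<Rightarrow> real) \<Rightarrow> real" where
  "total n a \<equiv> suminf (\<lambda>k. mass n (a k))"

lemma mass_nonneg: "positive n a \<Longrightarrow> 0 \<le> mass n a"
  by (intro sum_nonneg) (auto intro: less_imp_le)

lemma admissible_shift: "admissible n a \<Longrightarrow> admissible n (\<lambda>k. a (l + k))"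
  using summable_ignore_initial_segment[of "\<lambda>i. mass n (a i)" l]
  by (auto simp: admissible_def add.commute)

definition graft :: "nat \<Rightarrow> (nat \<Rightarrow> 'a) \<Rightarrow> (nat \<Rightarrow> 'a) \<Rightarrow> nat \<Rightarrow> 'a" where
  "graft l a b = (\<lambda>i. if i < l then a i else b (i - l))"

lemma graft_before: "i < l \<Longrightarrow> graft l a b i = a i"
  and graft_after: "graft l a b (l + i) = b i"
  by (simp_all add: graft_def)

lemma admissible_graft:
  assumes a: "\<And>i. i < l \<Longrightarrow> positive n (a i)" and b: "admissible n b"
  shows "admissible n (graft l a b)"
proof -
  have "summable (\<lambda>i. mass n (graft l a b (i + l)))"
    using b by (simp add: admissible_def graft_def)
  then have "summable (\<lambda>i. mass n (graft l a b i))"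
    using summable_iff_shift by blast
  then show ?thesis using a b by (auto simp: admissible_def graft_def)
qed

lemma dimat_lim_offset:
  "dimat_lim (\<lambda>k. P (l + k)) X \<longleftrightarrow> dimat_lim P X"
proof -
  have "(\<lambda>k. P (l + k) i j) \<longlonglongrightarrow> X i j \<longleftrightarrow> (\<lambda>k. P k i j) \<longlonglongrightarrow> X i j" for i j
    using LIMSEQ_ignore_initial_segment[of "\<lambda>k. P k i j" "X i j" l]
      LIMSEQ_offset[of "\<lambda>k. P k i j" l "X i j"] by (auto simp: add.commute)
  then show ?thesis by (simp add: dimat_lim_def)
qed

text \<open>The properties shared by whirls and curls on which the closure argument depends. In
  \<open>F_exchange\<close>, a factor with parameters \<open>b\<close> coming from the far right passes all the factors
  \<open>F (A k)\<close> on its way to the left; \<open>B k\<close> are its parameters just after it has passed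
  \<open>F (A k)\<close>, so that \<open>B k\<close> tends to \<open>b\<close>.\<close>

locale factor_family =
  fixes n :: nat and F :: "(int \<Rightarrow> real) \<Rightarrow> dimat"
  assumes F_U: "F a \<in> U n"
    and F_superdiagonal: "F a i (i + 1) = a (i mod int n)"
    and F_dominated: "positive n a \<Longrightarrow> dominated (mass n a) (F a)"
    and F_continuous:
      "(\<And>j. j \<in> {0..<int n} \<Longrightarrow> (\<lambda>k. A k j) \<longlonglongrightarrow> a j) \<Longrightarrow> dimat_lim (\<lambda>k. F (A k)) (F a)"
    and F_exchange:
      "admissible n A \<Longrightarrow> positive n b \<Longrightarrow>
       (\<And>j. j \<in> {0..<int n} \<Longrightarrow> total n A \<le> b j / 2) \<Longrightarrow>
       \<exists>B a'. (\<forall>k. positive n (B k)) \<and> admissible n a' \<and>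
         (\<forall>j\<in>{0..<int n}. (\<lambda>k. B k j) \<longlonglongrightarrow> b j) \<and>
         (\<forall>k. F (A k) **\<^sub>\<int> F (B (Suc k)) = F (B k) **\<^sub>\<int> F (a' k))"
begin

abbreviation partial :: "(nat \<Rightarrow> int \<Rightarrow> real) \<Rightarrow> nat \<Rightarrow> dimat" where
  "partial a \<equiv> right_partial (\<lambda>i. F (a i))"

definition RP :: "dimat set" where
  "RP = {X. \<exists>a. admissible n a \<and> has_right_prod (\<lambda>i. F (a i)) X}"

lemma partial_U: "partial a k \<in> U n"
  by (simp add: right_partial_U F_U)

lemma partial_add: "partial a (l + k) = partial a l **\<^sub>\<int> partial (\<lambda>i. a (l + i)) k"
  by (rule right_partial_add) (rule F_U)

lemma partial_dominated:
  "(\<And>i. i < k \<Longrightarrow> positive n (a i)) \<Longrightarrow> dominated (\<Sum>i<k. mass n (a i)) (partial a k)"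
proof (induction k)
  case 0
  show ?case by (simp add: dominated_one)
next
  case (Suc k)
  have "dominated (\<Sum>i<k. mass n (a i)) (partial a k)" using Suc by simp
  moreover have "dominated (mass n (a k)) (F (a k))" using Suc by (intro F_dominated) auto
  ultimately show ?case using dominated_mult[OF partial_U _ F_U] by simp
qed

lemma partial_mono:
  assumes "\<And>i. positive n (a i)"
  shows "incseq (\<lambda>k. partial a k i j)"
proof (rule incseq_SucI)
  fix k
  have "0 \<le> partial a k i j" for i j
    using partial_dominated[of k a] assms by (simp add: dominated_def)
  moreover have "0 \<le> F (a k) i j" for i j
    using F_dominated[of "a k"] assms by (simp add: dominated_def)
  ultimately show "partial a k i j \<le> partial a (Suc k) i j"
    using entry_le_mult[OF partial_U F_U] by simp
qed

lemma partial_dominated_suminf: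
  assumes "admissible n a"
  shows "dominated (total n a) (partial a k)"
proof (rule dominated_mono)
  show "dominated (\<Sum>i<k. mass n (a i)) (partial a k)"
    using assms by (intro partial_dominated) (auto simp: admissible_def)
  show "(\<Sum>i<k. mass n (a i)) \<le> total n a"
    using assms by (intro sum_le_suminf) (auto simp: admissible_def intro!: mass_nonneg)
qed

lemma right_prod_exists:
  assumes a: "admissible n a"
  shows "\<exists>X. has_right_prod (\<lambda>i. F (a i)) X"
proof -
  have "\<exists>x. (\<lambda>k. partial a k i j) \<longlonglongrightarrow> x" for i j
  proof (cases "i \<le> j")
    case True
    have "partial a k i j \<le> total n a ^ nat (j - i)" for k
      using partial_dominated_suminf[OF a, of k] True by (simp add: dominated_def)
    moreover have "incseq (\<lambda>k. partial a k i j)"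
      using a by (intro partial_mono) (simp add: admissible_def)
    ultimately show ?thesis by (metis incseq_convergent)
  next
    case False
    then have "(\<lambda>k. partial a k i j) = (\<lambda>k. 0)" using partial_U[of a] by (auto simp: U_def)
    then show ?thesis by auto
  qed
  then obtain X where "\<And>i j. (\<lambda>k. partial a k i j) \<longlonglongrightarrow> X i j" by metis
  then show ?thesis by (auto simp: has_right_prod_def dimat_lim_def)
qed

lemma right_prod_U: "has_right_prod (\<lambda>i. F (a i)) X \<Longrightarrow> X \<in> U n"
  unfolding has_right_prod_def by (rule U_lim[OF partial_U])

lemma RP_subset_U: "RP \<subseteq> U n"
  by (auto simp: RP_def right_prod_U)

lemma right_prod_dominated:
  "admissible n a \<Longrightarrow> has_right_prod (\<lambda>i. F (a i)) X \<Longrightarrow> dominated (total n a) X"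
  unfolding has_right_prod_def by (rule dominated_lim[OF partial_dominated_suminf])

lemma right_prod_append:
  assumes "has_right_prod (\<lambda>i. F (a (l + i))) T"
  shows "has_right_prod (\<lambda>i. F (a i)) (partial a l **\<^sub>\<int> T)"
proof -
  have "dimat_lim (\<lambda>k. partial a l **\<^sub>\<int> partial (\<lambda>i. a (l + i)) k) (partial a l **\<^sub>\<int> T)"
    using assms by (intro dimat_lim_mult[where n = n] partial_U dimat_lim_const) (simp add: has_right_prod_def)
  then show ?thesis
    unfolding has_right_prod_def partial_add[symmetric]
    by (simp add: dimat_lim_offset)
qed

lemma right_prod_split:
  assumes "admissible n a" and X: "has_right_prod (\<lambda>i. F (a i)) X"
  obtains T where "has_right_prod (\<lambda>i. F (a (l + i))) T" and "X = partial a l **\<^sub>\<int> T"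
proof -
  obtain T where T: "has_right_prod (\<lambda>i. F (a (l + i))) T"
    using right_prod_exists[OF admissible_shift[OF assms(1)]] by blast
  moreover have "X = partial a l **\<^sub>\<int> T"
    using right_prod_append[of a l, OF T] X unfolding has_right_prod_def by (rule dimat_lim_unique[rotated])
  ultimately show ?thesis using that by blast
qed

lemma right_prod_graft:
  assumes "has_right_prod (\<lambda>i. F (b i)) T"
  shows "has_right_prod (\<lambda>i. F (graft l a b i)) (partial a l **\<^sub>\<int> T)"
proof -
  have "partial (graft l a b) l = partial a l"
    by (rule right_partial_cong) (simp add: graft_before)
  moreover have "has_right_prod (\<lambda>i. F (graft l a b (l + i))) T"
    using assms by (simp add: graft_after)
  ultimately show ?thesis using right_prod_append[of "graft l a b" l T] by simp
qed

lemma suminf_tail_small: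
  assumes "admissible n a" and "0 < e"
  obtains l where "l \<ge> l0" and "total n (\<lambda>k. a (l + k)) \<le> e"
proof -
  have s: "summable (\<lambda>k. mass n (a k))" using assms by (simp add: admissible_def)
  obtain N where N: "\<And>m. m \<ge> N \<Longrightarrow> norm (total n (\<lambda>i. a (i + m))) < e"
    using suminf_exist_split[OF assms(2) s] by blast
  have "total n (\<lambda>k. a (max N l0 + k)) \<le> e"
    using N[of "max N l0"] by (simp add: add.commute)
  then show ?thesis using that[of "max N l0"] by simp
qed

text \<open>Only the tail \<open>T\<close> of \<open>X\<close> has to be passed by \<open>F b\<close>, and it can be taken so small that the exchange
  applies; the initial factors of \<open>X\<close> stay where they are.\<close>

lemma RP_mult_factor:
  assumes X: "X \<in> RP" and b: "positive n b"
  shows "X **\<^sub>\<int> F b \<in> RP"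
proof -
  obtain a where a: "admissible n a" and aX: "has_right_prod (\<lambda>i. F (a i)) X"
    using X by (auto simp: RP_def)
  \<comment> \<open>The number \<open>1\<close> only makes the set nonempty.\<close>
  define \<beta> where "\<beta> = Min (insert 1 (b ` {0..<int n}))"
  have \<beta>: "0 < \<beta>" using b by (auto simp: \<beta>_def)
  have \<beta>_le: "\<beta> \<le> b j" if "j \<in> {0..<int n}" for j using that unfolding \<beta>_def by (intro Min_le) auto
  obtain l where l: "total n (\<lambda>k. a (l + k)) \<le> \<beta> / 2"
    using suminf_tail_small[OF a, of "\<beta> / 2" 0] \<beta> by auto
  obtain T where T: "has_right_prod (\<lambda>i. F (a (l + i))) T" and XT: "X = partial a l **\<^sub>\<int> T"
    using right_prod_split[OF a aX] .
  have "total n (\<lambda>k. a (l + k)) \<le> b j / 2" if "j \<in> {0..<int n}" for j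
    using l \<beta>_le[OF that] by linarith
  then obtain B a' where B: "\<And>k. positive n (B k)" and a': "admissible n a'"
    and Blim: "\<And>j. j \<in> {0..<int n} \<Longrightarrow> (\<lambda>k. B k j) \<longlonglongrightarrow> b j"
    and ex: "\<And>k. F (a (l + k)) **\<^sub>\<int> F (B (Suc k)) = F (B k) **\<^sub>\<int> F (a' k)"
    using F_exchange[OF admissible_shift[OF a, of l] b] by metis
  let ?P = "partial (\<lambda>i. a (l + i))"
  \<comment> \<open>The factor \<open>F (B k)\<close> passes the first \<open>k\<close> factors of the tail.\<close>
  have move: "?P k **\<^sub>\<int> F (B k) = F (B 0) **\<^sub>\<int> partial a' k" for k
  proof (induction k)
    case 0
    show ?case by (simp add: dimat_one_mult[OF F_U] dimat_mult_one[OF F_U])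
  next
    case (Suc k)
    have "?P (Suc k) **\<^sub>\<int> F (B (Suc k)) = ?P k **\<^sub>\<int> (F (B k) **\<^sub>\<int> F (a' k))"
      by (simp add: dimat_mult_assoc[OF partial_U F_U F_U] ex)
    also have "\<dots> = F (B 0) **\<^sub>\<int> partial a' (Suc k)"
      by (simp add: Suc dimat_mult_assoc[OF F_U partial_U F_U] flip: dimat_mult_assoc[OF partial_U F_U F_U])
    finally show ?case .
  qed
  have TF: "dimat_lim (\<lambda>k. F (B 0) **\<^sub>\<int> partial a' k) (T **\<^sub>\<int> F b)"
    unfolding move[symmetric] using T
    by (intro dimat_lim_mult[where n = n] partial_U F_U F_continuous Blim) (simp add: has_right_prod_def)
  obtain T' where T': "has_right_prod (\<lambda>i. F (a' i)) T'"
    using right_prod_exists[OF a'] by blast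
  have "dimat_lim (\<lambda>k. F (B 0) **\<^sub>\<int> partial a' k) (F (B 0) **\<^sub>\<int> T')"
    using T' by (intro dimat_lim_mult[where n = n] partial_U F_U dimat_lim_const) (simp add: has_right_prod_def)
  then have TT': "T **\<^sub>\<int> F b = F (B 0) **\<^sub>\<int> T'" using TF dimat_lim_unique by blast
  have T'U: "T' \<in> U n" and TU: "T \<in> U n" using T T' right_prod_U[of "\<lambda>i. a (l + i)"] right_prod_U by blast+
  define c where "c = graft l a (graft 1 (\<lambda>_. B 0) a')"
  have XF: "X **\<^sub>\<int> F b = partial a l **\<^sub>\<int> (partial (\<lambda>_. B 0) 1 **\<^sub>\<int> T')"
    by (simp add: XT dimat_mult_assoc[OF partial_U TU F_U] TT' dimat_one_mult[OF F_U])
  have "has_right_prod (\<lambda>i. F (c i)) (X **\<^sub>\<int> F b)"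
    unfolding c_def XF by (rule right_prod_graft[OF right_prod_graft[OF T']])
  moreover have "admissible n c"
    unfolding c_def using a a' B by (intro admissible_graft) (auto simp: admissible_def)
  ultimately show ?thesis by (auto simp: RP_def)
qed

text \<open>One step of the diagonal construction: absorbing \<open>Y\<close> into the tail behind position \<open>l\<close> leaves
  the first \<open>l\<close> parameters unchanged, and a new cut \<open>l'\<close> further to the right makes the new tail small.\<close>

lemma refine_factorization:
  assumes a: "admissible n a" and X: "has_right_prod (\<lambda>i. F (a i)) X"
    and Y: "Y \<in> U n" "\<And>Z. Z \<in> RP \<Longrightarrow> Z **\<^sub>\<int> Y \<in> RP" and e: "0 < e"
  shows "\<exists>b l'. admissible n b \<and> has_right_prod (\<lambda>i. F (b i)) (X **\<^sub>\<int> Y) \<and> l < l' \<and>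
    (\<forall>i<l. b i = a i) \<and> total n (\<lambda>k. b (l' + k)) \<le> e"
proof -
  obtain T where T: "has_right_prod (\<lambda>i. F (a (l + i))) T" and XT: "X = partial a l **\<^sub>\<int> T"
    using right_prod_split[OF a X] .
  have "T \<in> RP" using T admissible_shift[OF a] by (auto simp: RP_def)
  then have "T **\<^sub>\<int> Y \<in> RP" by (rule Y)
  then obtain c where c: "admissible n c" and cT: "has_right_prod (\<lambda>i. F (c i)) (T **\<^sub>\<int> Y)"
    by (auto simp: RP_def)
  define b where "b = graft l a c"
  have b: "admissible n b" unfolding b_def using a c by (intro admissible_graft) (auto simp: admissible_def)
  obtain l' where "l' \<ge> Suc l" and "total n (\<lambda>k. b (l' + k)) \<le> e"
    using suminf_tail_small[OF b e] .
  moreover have "has_right_prod (\<lambda>i. F (b i)) (X **\<^sub>\<int> Y)"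
  proof -
    have "T \<in> U n" using T right_prod_U[of "\<lambda>i. a (l + i)"] by blast
    then show ?thesis
      unfolding b_def using right_prod_graft[OF cT] by (simp add: XT dimat_mult_assoc[OF partial_U _ Y(1)])
  qed
  ultimately show ?thesis using b by (intro exI[of _ b] exI[of _ l']) (auto simp: b_def graft_before)
qed

text \<open>The diagonal construction. Successive factorizations of the \<open>P m\<close> agree on longer and longer
  initial parts, and the common limit sequence \<open>b\<close> of parameters represents \<open>L\<close>: along the cuts
  \<open>l m\<close> its partial products are the \<open>P m\<close> with their small tails removed, and monotonicity
  extends convergence from the cuts to all partial products. The total mass of \<open>b\<close> is finite since it
  can be read off the superdiagonal of \<open>L\<close>.\<close>

lemma RP_closed:
  assumes P0: "P 0 \<in> RP" and P_Suc: "\<And>m. P (Suc m) = P m **\<^sub>\<int> Y m"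
    and Y: "\<And>m. Y m \<in> U n" "\<And>m Z. Z \<in> RP \<Longrightarrow> Z **\<^sub>\<int> Y m \<in> RP"
    and lim: "dimat_lim P L"
  shows "L \<in> RP"
proof -
  let ?e = "\<lambda>m. inverse (real (Suc m))"
  let ?Q = "\<lambda>m (a, l). admissible n a \<and> has_right_prod (\<lambda>i. F (a i)) (P m) \<and>
     total n (\<lambda>k. a (l + k)) \<le> ?e m"
  let ?R = "\<lambda>m (a, l) (b, l'). l < l' \<and> (\<forall>i<l. b i = a i)"
  have "\<exists>f. \<forall>m. ?Q m (f m) \<and> ?R m (f m) (f (Suc m))"
  proof (rule dependent_nat_choice)
    obtain a where a: "admissible n a" "has_right_prod (\<lambda>i. F (a i)) (P 0)"
      using P0 by (auto simp: RP_def)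
    moreover obtain l where "total n (\<lambda>k. a (l + k)) \<le> ?e 0"
      using suminf_tail_small[OF a(1), of "?e 0" 0] by auto
    ultimately show "\<exists>x. ?Q 0 x" by auto
  next
    fix x m assume x: "?Q m x"
    obtain a l where al: "x = (a, l)" by (cases x)
    have ad: "admissible n a" "has_right_prod (\<lambda>i. F (a i)) (P m)" using x by (auto simp: al)
    obtain b l' where "admissible n b" "has_right_prod (\<lambda>i. F (b i)) (P (Suc m))"
      "l < l'" "\<forall>i<l. b i = a i" "total n (\<lambda>k. b (l' + k)) \<le> ?e (Suc m)"
      using refine_factorization[OF ad Y(1)[of m] Y(2)[of _ m], of "?e (Suc m)" l] unfolding P_Suc[symmetric] by auto
    then show "\<exists>y. ?Q (Suc m) y \<and> ?R m x y"
      unfolding al by (intro exI[of _ "(b, l')"]) auto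
  qed
  then obtain f where f: "\<forall>m. ?Q m (f m) \<and> ?R m (f m) (f (Suc m))" ..
  define a where "a = fst \<circ> f"
  define l where "l = snd \<circ> f"
  have ad: "admissible n (a m)" and aP: "has_right_prod (\<lambda>i. F (a m i)) (P m)"
    and small: "total n (\<lambda>k. a m (l m + k)) \<le> ?e m" for m
    using spec[OF f, of m] by (auto simp: a_def l_def split_beta)
  have lSuc: "l m < l (Suc m)" and agree: "\<And>i. i < l m \<Longrightarrow> a (Suc m) i = a m i" for m
    using spec[OF f, of m] by (auto simp: a_def l_def split_beta)
  have mono: "strict_mono l" using lSuc by (simp add: strict_mono_Suc_iff)
  have agree': "a (m + d) i = a m i" if "i < l m" for m d i
  proof (induction d)
    case (Suc d)
    have "l m \<le> l (m + d)" using mono by (simp add: strict_mono_less_eq)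
    then show ?case using agree[of i "m + d"] that Suc by simp
  qed simp
  \<comment> \<open>The index \<open>Suc i\<close> guarantees \<open>i < l (Suc i)\<close>, so that the \<open>i\<close>-th parameter has become stationary.\<close>
  define b where "b i = a (Suc i) i" for i
  have b: "b i = a m i" if "i < l m" for m i
  proof (cases "m \<le> Suc i")
    case True
    then show ?thesis using agree'[OF that, of "Suc i - m"] by (simp add: b_def)
  next
    case False
    have "i < l (Suc i)" using strict_mono_imp_increasing[OF mono, of "Suc i"] by simp
    then show ?thesis using agree'[of i "Suc i" "m - Suc i"] False by (simp add: b_def)
  qed
  have bpos: "positive n (b i)" for i using ad[of "Suc i"] by (auto simp: b_def admissible_def)
  have bpart: "partial b (l m) = partial (a m) (l m)" for m
    by (rule right_partial_cong) (simp add: b)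
  have bnn: "0 \<le> partial b k i j" for k i j
    using partial_dominated[of k b] bpos by (simp add: dominated_def)
  have "\<exists>T. has_right_prod (\<lambda>i. F (a m (l m + i))) T \<and> P m = partial (a m) (l m) **\<^sub>\<int> T" for m
    using right_prod_split[OF ad aP] by metis
  then obtain T where T: "\<And>m. has_right_prod (\<lambda>i. F (a m (l m + i))) (T m)"
    and PT: "\<And>m. P m = partial b (l m) **\<^sub>\<int> T m"
    unfolding bpart by metis
  have TU: "T m \<in> U n" for m by (rule right_prod_U[OF T])
  have Tdom: "dominated (?e m) (T m)" for m
    using right_prod_dominated[OF admissible_shift[OF ad] T] small by (rule dominated_mono)
  have sub: "dimat_lim (\<lambda>m. partial b (l m)) L"
    by (rule dimat_lim_cancel_right[OF partial_U bnn TU Tdom LIMSEQ_inverse_real_of_nat])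
       (use lim PT in \<open>simp add: fun_eq_iff[symmetric] flip: PT\<close>)
  have le: "partial b k i j \<le> L i j" for k i j
  proof (rule LIMSEQ_le_const)
    show "(\<lambda>m. partial b (l m) i j) \<longlonglongrightarrow> L i j" using sub by (simp add: dimat_lim_def)
    have "partial b k i j \<le> partial b (l m) i j" if "k \<le> m" for m
      using incseqD[OF partial_mono[OF bpos], of k "l m"]
        strict_mono_imp_increasing[OF mono, of m] that by simp
    then show "\<exists>N. \<forall>m\<ge>N. partial b k i j \<le> partial b (l m) i j" by blast
  qed
  have "has_right_prod (\<lambda>i. F (b i)) L"
    unfolding has_right_prod_def dimat_lim_def
  proof (intro allI)
    fix i j
    have "\<forall>k. partial b k i j \<le> L i j" using le by blast
    then obtain x where x: "(\<lambda>k. partial b k i j) \<longlonglongrightarrow> x"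
      by (rule incseq_convergent[OF partial_mono[of b, OF bpos]])
    have "(\<lambda>m. partial b (l m) i j) \<longlonglongrightarrow> x"
      using LIMSEQ_subseq_LIMSEQ[OF x mono] by (simp add: o_def)
    moreover have "(\<lambda>m. partial b (l m) i j) \<longlonglongrightarrow> L i j" using sub by (simp add: dimat_lim_def)
    ultimately have "x = L i j" by (rule LIMSEQ_unique)
    then show "(\<lambda>k. partial b k i j) \<longlonglongrightarrow> L i j" using x by simp
  qed
  moreover have "summable (\<lambda>k. mass n (b k))"
  proof (rule bounded_imp_summable)
    fix k
    show "0 \<le> mass n (b k)" using bpos by (rule mass_nonneg)
    have "(\<Sum>i\<le>k. mass n (b i)) = (\<Sum>j\<in>{0..<int n}. partial b (Suc k) j (j + 1))"
      unfolding right_partial_superdiagonal[OF F_U] F_superdiagonal lessThan_Suc_atMost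
      by (subst sum.swap) simp
    also have "\<dots> \<le> (\<Sum>j\<in>{0..<int n}. L j (j + 1))" by (intro sum_mono le)
    finally show "(\<Sum>i\<le>k. mass n (b i)) \<le> (\<Sum>j\<in>{0..<int n}. L j (j + 1))" .
  qed
  ultimately show ?thesis using bpos by (auto simp: RP_def admissible_def)
qed

text \<open>\<open>RP_closed\<close> is used twice: with single factors for \<open>Y\<close>, to get closure under multiplication, and
  then, this being known, with arbitrary members of \<open>RP\<close>.\<close>

theorem RP_right_limit_semigroup: "right_limit_semigroup n RP"
proof -
  have mult: "X **\<^sub>\<int> Y \<in> RP" if X: "X \<in> RP" and Y: "Y \<in> RP" for X Y
  proof -
    obtain b where b: "admissible n b" and bY: "has_right_prod (\<lambda>i. F (b i)) Y"
      using Y by (auto simp: RP_def)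
    have XU: "X \<in> U n" using X RP_subset_U by blast
    show ?thesis
    proof (rule RP_closed[where P = "\<lambda>m. X **\<^sub>\<int> partial b m" and Y = "\<lambda>m. F (b m)"])
      show "X **\<^sub>\<int> partial b 0 \<in> RP" using X by (simp add: dimat_mult_one[OF XU])
      show "dimat_lim (\<lambda>m. X **\<^sub>\<int> partial b m) (X **\<^sub>\<int> Y)"
        using bY by (intro dimat_lim_mult[where n = n] XU partial_U dimat_lim_const) (simp add: has_right_prod_def)
      show "Z **\<^sub>\<int> F (b m) \<in> RP" if "Z \<in> RP" for m Z
        using that b by (intro RP_mult_factor) (auto simp: admissible_def)
    qed (simp_all add: F_U dimat_mult_assoc[OF XU partial_U F_U])
  qed
  moreover have "L \<in> RP" if X: "\<And>k. X k \<in> RP" and L: "has_right_prod X L" for X L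
  proof (rule RP_closed[where P = "\<lambda>m. right_partial X (Suc m)" and Y = "\<lambda>m. X (Suc m)"])
    have XU: "X k \<in> U n" for k using X RP_subset_U by blast
    then show "X (Suc m) \<in> U n" for m .
    show "right_partial X (Suc 0) \<in> RP" using X by (simp add: dimat_one_mult[OF XU])
    show "dimat_lim (\<lambda>m. right_partial X (Suc m)) L"
      using L dimat_lim_offset[of "right_partial X" 1] by (simp add: has_right_prod_def)
  qed (use X mult in auto)
  ultimately show ?thesis
    using RP_subset_U by (auto simp: right_limit_semigroup_def subsemigroup_U_def)
qed

end

section \<open>Solving the exchange relations\<close>

abbreviation periodic :: "nat \<Rightarrow> (int \<Rightarrow> real) \<Rightarrow> bool" where
  "periodic n a \<equiv> \<forall>i. a (i + int n) = a i"

text \<open>\<open>path_weight c l j i\<close> is the sum of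
  \<open>c\<^bsub>m(1)\<^esub>(i - 1) c\<^bsub>m(2)\<^esub>(i - 2) \<cdots> c\<^bsub>m(l)\<^esub>(i - l)\<close> over all chains \<open>j \<le> m(1) \<le> m(2) \<le> \<cdots> \<le> m(l)\<close>. These
  are the homogeneous parts of the solution of the recursion in \<open>transport_recursion\<close>, graded by
  the degree in \<open>c\<close>.\<close>

primrec path_weight :: "(nat \<Rightarrow> int \<Rightarrow> real) \<Rightarrow> nat \<Rightarrow> nat \<Rightarrow> int \<Rightarrow> real" where
  "path_weight c 0 = (\<lambda>j i. 1)"
| "path_weight c (Suc l) = (\<lambda>j i. suminf (\<lambda>m. c (j + m) (i - 1) * path_weight c l (j + m) (i - 1)))"

lemma path_weight_facts:
  assumes c: "\<And>k i. 0 < c k i" and s: "\<And>i. summable (\<lambda>k. c k i)"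
    and half: "\<And>i. suminf (\<lambda>k. c k i) \<le> 1 / 2"
  shows path_weight_nonneg: "0 \<le> path_weight c l j i"
    and path_weight_le: "path_weight c l j i \<le> (1 / 2) ^ l"
    and path_weight_summable:
      "summable (\<lambda>m. c (j + m) (i - 1) * path_weight c l (j + m) (i - 1))"
    and path_weight_Suc_le:
      "path_weight c (Suc l) j i \<le> suminf (\<lambda>m. c (j + m) (i - 1)) * (1 / 2) ^ l"
proof -
  have tail: "summable (\<lambda>m. c (j + m) i)" for j i
    using summable_ignore_initial_segment[OF s[of i], of j] by (simp add: add.commute)
  have tail_le: "suminf (\<lambda>m. c (j + m) i) \<le> 1 / 2" for j i
    using suminf_split_initial_segment[OF s[of i], of j] half[of i] sum_nonneg[of "{..<j}" "\<lambda>k. c k i"]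
      less_imp_le[OF c] by (simp add: add.commute)
  have step: "summable (\<lambda>m. c (j + m) (i - 1) * path_weight c l (j + m) (i - 1)) \<and>
      0 \<le> path_weight c (Suc l) j i \<and>
      path_weight c (Suc l) j i \<le> suminf (\<lambda>m. c (j + m) (i - 1)) * (1 / 2) ^ l"
    if IH: "\<And>j i. 0 \<le> path_weight c l j i \<and> path_weight c l j i \<le> (1 / 2) ^ l" for l j i
  proof (intro conjI)
    have le: "c (j + m) (i - 1) * path_weight c l (j + m) (i - 1) \<le> c (j + m) (i - 1) * (1 / 2) ^ l"
      and nn: "0 \<le> c (j + m) (i - 1) * path_weight c l (j + m) (i - 1)" for m
      using IH[of "j + m" "i - 1"] less_imp_le[OF c, of "j + m" "i - 1"]
      by (auto intro: mult_left_mono)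
    have majorant: "summable (\<lambda>m. c (j + m) (i - 1) * (1 / 2) ^ l)"
      using tail by (rule summable_mult2)
    show *: "summable (\<lambda>m. c (j + m) (i - 1) * path_weight c l (j + m) (i - 1))"
      by (rule summable_comparison_test'[OF majorant]) (use le nn in simp)
    show "0 \<le> path_weight c (Suc l) j i"
      using suminf_nonneg[OF * nn] by simp
    have "path_weight c (Suc l) j i \<le> suminf (\<lambda>m. c (j + m) (i - 1) * (1 / 2) ^ l)"
      using suminf_le[OF le * majorant] by simp
    also have "\<dots> = suminf (\<lambda>m. c (j + m) (i - 1)) * (1 / 2) ^ l"
      by (rule suminf_mult2[OF tail, symmetric])
    finally show "path_weight c (Suc l) j i \<le> suminf (\<lambda>m. c (j + m) (i - 1)) * (1 / 2) ^ l" .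
  qed
  have bounds: "0 \<le> path_weight c l j i \<and> path_weight c l j i \<le> (1 / 2) ^ l" for l j i
  proof (induction l arbitrary: j i)
    case (Suc l)
    have "suminf (\<lambda>m. c (j + m) (i - 1)) * (1 / 2) ^ l \<le> 1 / 2 * (1 / 2) ^ l"
      by (intro mult_right_mono tail_le) simp
    also have "\<dots> = (1 / 2) ^ Suc l" by simp
    finally show ?case using step[of l j i, OF Suc] order_trans by blast
  qed simp
  show "0 \<le> path_weight c l j i" "path_weight c l j i \<le> (1 / 2) ^ l" using bounds by blast+
  show "summable (\<lambda>m. c (j + m) (i - 1) * path_weight c l (j + m) (i - 1))"
    "path_weight c (Suc l) j i \<le> suminf (\<lambda>m. c (j + m) (i - 1)) * (1 / 2) ^ l"
    using step[of l j i, OF bounds] by blast+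
qed

lemma suminf_tail_tendsto_zero:
  fixes f :: "nat \<Rightarrow> real"
  assumes "summable f"
  shows "(\<lambda>k. suminf (\<lambda>m. f (k + m))) \<longlonglongrightarrow> 0"
proof -
  have "(\<lambda>k. suminf f - (\<Sum>m<k. f m)) \<longlonglongrightarrow> suminf f - suminf f"
    by (intro tendsto_diff tendsto_const summable_LIMSEQ assms)
  then show ?thesis
    by (simp add: suminf_minus_initial_segment[OF assms, symmetric] add.commute)
qed

text \<open>The recursion leads from \<open>x (Suc k)\<close> back to \<open>x k\<close>, and the prescribed limit \<open>1\<close> plays the role of
  the initial value at \<open>k = \<infinity>\<close>. Iterating it gives
  \<open>x k (i + 1) = 1 + c k i * x k i + c (k + 1) i * x (k + 1) i + \<cdots>\<close>, and substituting this into itself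
  gives the sum of all path weights. It is dominated by a geometric series because the sums of the
  \<open>c k i\<close> over \<open>k\<close> are at most one half.\<close>

lemma transport_recursion:
  assumes c: "\<And>k i. 0 < c k i" and per: "\<And>k. periodic n (c k)"
    and s: "\<And>i. summable (\<lambda>k. c k i)" and half: "\<And>i. suminf (\<lambda>k. c k i) \<le> 1 / 2"
  shows "\<exists>x. (\<forall>k. periodic n (x k)) \<and> (\<forall>k i. 0 < x k i) \<and>
    (\<forall>k i. x k (i + 1) = x (Suc k) (i + 1) + c k i * x k i) \<and> (\<forall>i. (\<lambda>k. x k i) \<longlonglongrightarrow> (1::real))"
proof -
  let ?h = "path_weight c"
  note nonneg = path_weight_nonneg[of c, OF c s half]
  note le = path_weight_le[of c, OF c s half]
  define x where "x k i = suminf (\<lambda>l. ?h l k i)" for k i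
  have geo: "summable (\<lambda>l. (1 / 2 :: real) ^ l)" by (rule summable_geometric) simp
  have sum_h: "summable (\<lambda>l. ?h l k i)" for k i
    by (rule summable_comparison_test'[OF geo]) (use le nonneg in simp)
  have sum_h': "summable (\<lambda>l. ?h (Suc l) k i)" for k i
    using sum_h[of k i] summable_Suc_iff[of "\<lambda>l. ?h l k i"] by blast
  have x_head: "x k i = 1 + suminf (\<lambda>l. ?h (Suc l) k i)" for k i
    using suminf_split_head[OF sum_h[of k i]] by (simp add: x_def del: path_weight.simps(2))
  have tail0: "0 \<le> suminf (\<lambda>l. ?h (Suc l) k i)" for k i
    by (intro suminf_nonneg sum_h' nonneg)
  \<comment> \<open>Chains whose first element is \<open>k\<close>, and those whose first element is larger.\<close>
  have h_Suc: "?h (Suc l) k (i + 1) = c k i * ?h l k i + ?h (Suc l) (Suc k) (i + 1)" for l k i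
    using suminf_split_head[OF path_weight_summable[of c k "i + 1" l, OF c s half]] by simp
  have "x k (i + 1) = x (Suc k) (i + 1) + c k i * x k i" for k i
  proof -
    have "x k (i + 1) = 1 + suminf (\<lambda>l. c k i * ?h l k i + ?h (Suc l) (Suc k) (i + 1))"
      unfolding x_head[of k] by (subst h_Suc) (rule refl)
    also have "\<dots> = 1 + (c k i * x k i + suminf (\<lambda>l. ?h (Suc l) (Suc k) (i + 1)))"
      using suminf_add[OF summable_mult[OF sum_h[of k i], of "c k i"] sum_h'[of "Suc k" "i + 1"]]
      by (simp add: x_def suminf_mult[OF sum_h] del: path_weight.simps)
    finally show ?thesis by (simp add: x_head[of "Suc k"] del: path_weight.simps)
  qed
  moreover have "periodic n (x k)" for k
  proof -
    have "?h l k (i + int n) = ?h l k i" for l k i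
    proof (induction l arbitrary: k i)
      case (Suc l)
      have "c m (i + int n - 1) = c m (i - 1)" "?h l m (i + int n - 1) = ?h l m (i - 1)" for m
        using per[of m] Suc[of m "i - 1"] by (metis diff_add_eq)+
      then show ?case by simp
    qed simp
    then show ?thesis by (simp add: x_def)
  qed
  moreover have "0 < x k i" for k i using tail0[of k i] by (simp add: x_head del: path_weight.simps)
  moreover have "(\<lambda>k. x k i) \<longlonglongrightarrow> 1" for i
  proof -
    let ?t = "\<lambda>k. suminf (\<lambda>m. c (k + m) (i - 1))"
    have up: "x k i \<le> 1 + ?t k * 2" for k
    proof -
      have "suminf (\<lambda>l. ?h (Suc l) k i) \<le> suminf (\<lambda>l. ?t k * (1 / 2) ^ l)"
        by (intro suminf_le sum_h' summable_mult geo path_weight_Suc_le[of c, OF c s half])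
      also have "\<dots> = ?t k * 2"
        by (subst suminf_mult[OF geo]) (simp add: suminf_geometric)
      finally show ?thesis by (simp add: x_head del: path_weight.simps)
    qed
    have "?t \<longlonglongrightarrow> 0" using suminf_tail_tendsto_zero[OF s[of "i - 1"]] .
    then have "(\<lambda>k. 1 + ?t k * 2) \<longlonglongrightarrow> 1 + 0 * 2" by (intro tendsto_intros)
    then show ?thesis
      using up tail0 by (intro tendsto_sandwich[OF _ _ tendsto_const, of 1 "\<lambda>k. x k i" _ "\<lambda>k. 1 + ?t k * 2"])
        (auto simp: x_head simp del: path_weight.simps)
  qed
  ultimately show ?thesis by (intro exI[of _ x]) blast
qed

lemma periodic_mod:
  assumes "periodic n a" shows "a (i mod int n) = a i"
proof -
  have "a (j + int n * int m) = a j" for j m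
  proof (induction m)
    case (Suc m)
    have "a (j + int n * int (Suc m)) = a ((j + int n * int m) + int n)"
      by (simp add: algebra_simps)
    also have "\<dots> = a (j + int n * int m)" using assms by blast
    finally show ?case using Suc by simp
  qed simp
  note nat_mult = this
  have "a (j + int n * q) = a j" for j q
  proof (cases "0 \<le> q")
    case True
    then show ?thesis using nat_mult[of j "nat q"] by simp
  next
    case False
    then show ?thesis using nat_mult[of "j + int n * q" "nat (- q)"] by simp
  qed
  from this[of "i mod int n" "i div int n"] show ?thesis by simp
qed

text \<open>The last two equations are the entrywise form of \<open>M(a\<^sup>k) M(B\<^bsup>k+1\<^esup>) = M(B\<^sup>k) M(a'\<^sup>k)\<close> for whirls. Let
  \<open>p\<close> be the positive sequence with \<open>p (i + 1) = b i * p i\<close>, which up to alternating signs is the left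
  null vector of \<open>M(b)\<close>. With \<open>q k i = p i * x k i\<close> for the solution \<open>x\<close> of the recursion for
  \<open>c k i = a k i / b i\<close>, that recursion reads \<open>q k (i + 1) - a k i * q k i = q (k + 1) (i + 1)\<close>: up to
  signs, \<open>M(a\<^sup>k)\<close> carries \<open>q k\<close> to \<open>q (k + 1)\<close>. The whirl with left null vector \<open>q k\<close> has the
  parameters \<open>B k i = q k (i + 1) / q k i\<close>. Working with the ratio \<open>x\<close> instead of \<open>q\<close> keeps everything
  periodic.

  The \<open>a' k\<close> are summable because, by the first equation, \<open>a' k - a k\<close> is the increment of the
  convergent sequence \<open>B\<close>.\<close>

lemma scalar_exchange:
  assumes n: "n \<ge> 1"
    and a: "\<And>k i. 0 < a k i" "\<And>k. periodic n (a k)" "summable (\<lambda>k. mass n (a k))"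
    and b: "\<And>i. 0 < b i" "periodic n b"
    and small: "\<And>j. total n a \<le> b j / 2"
  shows "\<exists>B a'. (\<forall>k i. 0 < B k i) \<and> (\<forall>k. periodic n (B k)) \<and>
    (\<forall>k i. 0 < a' k i) \<and> (\<forall>k. periodic n (a' k)) \<and> (\<forall>i. summable (\<lambda>k. a' k i)) \<and>
    (\<forall>i. (\<lambda>k. B k i) \<longlonglongrightarrow> b i) \<and>
    (\<forall>k i. a k i + B (Suc k) i = a' k i + B k i) \<and>
    (\<forall>k i. a k i * B (Suc k) (i + 1) = B k i * a' k (i + 1))"
proof -
  define c where "c k i = a k i / b i" for k i
  have a_le: "a k i \<le> mass n (a k)" for k i
  proof -
    have "a k (i mod int n) \<le> mass n (a k)"
      using n a(1) by (intro member_le_sum) (auto intro: less_imp_le)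
    then show ?thesis by (simp add: periodic_mod[OF a(2)])
  qed
  have a_sum: "summable (\<lambda>k. a k i)" for i
    by (rule summable_comparison_test'[OF a(3)]) (use a_le a(1)[THEN less_imp_le] in simp)
  have c: "0 < c k i" "periodic n (c k)" "summable (\<lambda>k. c k i)" "suminf (\<lambda>k. c k i) \<le> 1 / 2" for k i
  proof -
    show "0 < c k i" "periodic n (c k)" using a b by (simp_all add: c_def)
    show "summable (\<lambda>k. c k i)" unfolding c_def by (rule summable_divide[OF a_sum])
    have "suminf (\<lambda>k. a k i) \<le> b i / 2"
      using suminf_le[OF a_le a_sum a(3), of i] small[of i] by simp
    then have "suminf (\<lambda>k. a k i) / b i \<le> (b i / 2) / b i"
      using b(1)[of i] by (intro divide_right_mono) auto
    then show "suminf (\<lambda>k. c k i) \<le> 1 / 2"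
      unfolding c_def using b(1)[of i] by (simp add: suminf_divide[OF a_sum])
  qed
  obtain x where x_per: "\<And>k. periodic n (x k)" and x_pos: "\<And>k i. 0 < x k i"
    and x_rec: "\<And>k i. x k (i + 1) = x (Suc k) (i + 1) + c k i * x k i"
    and x_lim: "\<And>i. (\<lambda>k. x k i) \<longlonglongrightarrow> (1::real)"
    using transport_recursion[of c n, OF c] by metis
  define B where "B k i = b i * x k (i + 1) / x k i" for k i
  define a' where "a' k i = a k (i - 1) * B (Suc k) i / B k (i - 1)" for k i
  have B_pos: "0 < B k i" for k i using x_pos b by (simp add: B_def)
  have B_per: "periodic n (B k)" for k
    using x_per[of k] b(2) unfolding B_def by (metis add.assoc add.commute)
  have a'_per: "periodic n (a' k)" for k
  proof
    fix i
    have "a k (i + int n - 1) = a k (i - 1)" "B k (i + int n - 1) = B k (i - 1)"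
      using a(2)[of k] B_per[of k] by (metis diff_add_eq)+
    then show "a' k (i + int n) = a' k i" using B_per[of "Suc k"] by (simp add: a'_def)
  qed
  have B_lim: "(\<lambda>k. B k i) \<longlonglongrightarrow> b i" for i
  proof -
    have "(\<lambda>k. B k i) \<longlonglongrightarrow> b i * 1 / 1" unfolding B_def by (intro tendsto_intros x_lim) simp
    then show ?thesis by simp
  qed
  have add: "a k i + B (Suc k) i = a' k i + B k i" for k i
  proof -
    have B_i: "B k i = b i * x (Suc k) (i + 1) / x k i + a k i"
      using x_pos[of k i] b(1)[of i] unfolding B_def x_rec[of k i] c_def by (simp add: field_simps)
    have "a' k i = (c k (i - 1) * x k (i - 1)) * B (Suc k) i / (x k i)"
      using x_pos[of k i] x_pos[of k "i - 1"] b(1)[of "i - 1"]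
      unfolding a'_def B_def[of k "i - 1"] c_def by (simp add: field_simps)
    also have "c k (i - 1) * x k (i - 1) = x k i - x (Suc k) i"
      using x_rec[of k "i - 1"] by simp
    also have "(x k i - x (Suc k) i) * B (Suc k) i / x k i = B (Suc k) i - x (Suc k) i * B (Suc k) i / x k i"
      using x_pos[of k i] by (simp add: field_simps)
    also have "x (Suc k) i * B (Suc k) i = b i * x (Suc k) (i + 1)"
      using x_pos[of "Suc k" i] by (simp add: B_def)
    finally show ?thesis using B_i by simp
  qed
  have "summable (\<lambda>k. a' k i)" for i
  proof -
    have "a' k i = a k i + (B (Suc k) i - B k i)" for k using add[of k i] by simp
    then show ?thesis
      using summable_add[OF a_sum telescope_summable[OF B_lim]] by simp
  qed
  moreover have "a k i * B (Suc k) (i + 1) = B k i * a' k (i + 1)" for k i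
    using B_pos[of k i] by (simp add: a'_def)
  moreover have "0 < a' k i" for k i using a(1) B_pos by (simp add: a'_def)
  ultimately show ?thesis using B_pos B_per a'_per B_lim add by (intro exI[of _ B] exI[of _ a']) blast
qed

section \<open>Whirls and curls\<close>

lemma whirl_U: "whirl n a \<in> U n"
  by (auto simp: U_def whirl_def)

lemma curl_U: "curl n a \<in> U n"
proof -
  have "(\<Prod>k\<in>{i + int n..<j + int n}. a (k mod int n)) = (\<Prod>k\<in>{i..<j}. a (k mod int n))" for i j
    by (rule prod.reindex_bij_witness[of _ "\<lambda>k. k + int n" "\<lambda>k. k - int n"])
       (auto simp: mod_diff_eq[of _ "int n" "int n", symmetric])
  then show ?thesis by (auto simp: U_def curl_def)
qed

lemma le_mass:
  assumes "n \<ge> 1" "positive n a"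
  shows "a (k mod int n) \<le> mass n a" and "0 < a (k mod int n)"
proof -
  have k: "k mod int n \<in> {0..<int n}" using assms by auto
  then show "0 < a (k mod int n)" using assms(2) by blast
  show "a (k mod int n) \<le> mass n a"
    using k assms(2) by (intro member_le_sum) (auto intro: less_imp_le)
qed

lemma whirl_dominated:
  assumes n: "n \<ge> 1" and a: "positive n a"
  shows "dominated (mass n a) (whirl n a)"
  using le_mass[OF n a] mass_nonneg[OF a] less_imp_le[OF le_mass(2)[OF n a]]
  by (auto simp: dominated_def whirl_def)

lemma curl_dominated:
  assumes n: "n \<ge> 1" and a: "positive n a"
  shows "dominated (mass n a) (curl n a)"
proof -
  have "(\<Prod>k\<in>{i..<j}. a (k mod int n)) \<le> mass n a ^ nat (j - i)" for i j
  proof -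
    have "(\<Prod>k\<in>{i..<j}. a (k mod int n)) \<le> (\<Prod>k\<in>{i..<j}. mass n a)"
      using le_mass[OF n a] by (intro prod_mono) (auto intro: less_imp_le)
    then show ?thesis by simp
  qed
  moreover have "0 \<le> (\<Prod>k\<in>{i..<j}. a (k mod int n))" for i j
    using less_imp_le[OF le_mass(2)[OF n a]] by (intro prod_nonneg) auto
  ultimately show ?thesis
    using mass_nonneg[OF a] by (auto simp: dominated_def curl_def)
qed

lemma whirl_mult_entry:
  "(whirl n a **\<^sub>\<int> X) i j = X i j + a (i mod int n) * X (i + 1) j" if X: "X \<in> U n"
proof -
  have "(whirl n a **\<^sub>\<int> X) i j = (\<Sum>k\<in>{i, i + 1} \<union> {i..j}. whirl n a i k * X k j)"
    by (rule dimat_mult_U_superset[OF whirl_U X]) auto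
  also have "\<dots> = (\<Sum>k\<in>{i, i + 1}. whirl n a i k * X k j)"
    by (intro sum.mono_neutral_right) (auto simp: whirl_def)
  finally show ?thesis by (simp add: whirl_def)
qed

lemma mult_whirl_entry:
  "(X **\<^sub>\<int> whirl n a) i j = X i j + X i (j - 1) * a ((j - 1) mod int n)" if X: "X \<in> U n"
proof -
  have "(X **\<^sub>\<int> whirl n a) i j = (\<Sum>k\<in>{j - 1, j} \<union> {i..j}. X i k * whirl n a k j)"
    by (rule dimat_mult_U_superset[OF X whirl_U]) auto
  also have "\<dots> = (\<Sum>k\<in>{j - 1, j}. X i k * whirl n a k j)"
    by (intro sum.mono_neutral_right) (auto simp: whirl_def)
  finally show ?thesis by (simp add: whirl_def)
qed

lemma whirl_exchange:
  assumes "\<And>i. a (i mod int n) + b (i mod int n) = a' (i mod int n) + b' (i mod int n)"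
    and "\<And>i. a (i mod int n) * b ((i + 1) mod int n) = b' (i mod int n) * a' ((i + 1) mod int n)"
  shows "whirl n a **\<^sub>\<int> whirl n b = whirl n b' **\<^sub>\<int> whirl n a'"
proof (intro ext)
  fix i j
  show "(whirl n a **\<^sub>\<int> whirl n b) i j = (whirl n b' **\<^sub>\<int> whirl n a') i j"
    unfolding whirl_mult_entry[OF whirl_U]
    using assms[of i] by (auto simp: whirl_def add.commute)
qed

lemma curl_left_inverse: "curl n a **\<^sub>\<int> whirl n (\<lambda>i. - a i) = dimat_one"
proof (intro ext)
  fix i j :: int
  have "{i..<j} = insert (j - 1) {i..<j - 1}" if "i < j" using that by auto
  then show "(curl n a **\<^sub>\<int> whirl n (\<lambda>i. - a i)) i j = dimat_one i j"
    unfolding mult_whirl_entry[OF curl_U] by (auto simp: curl_def dimat_one_def)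
qed

lemma curl_right_inverse: "whirl n (\<lambda>i. - a i) **\<^sub>\<int> curl n a = dimat_one"
proof (intro ext)
  fix i j :: int
  have "{i..<j} = insert i {i + 1..<j}" if "i < j" using that by auto
  then show "(whirl n (\<lambda>i. - a i) **\<^sub>\<int> curl n a) i j = dimat_one i j"
    unfolding whirl_mult_entry[OF curl_U] by (auto simp: curl_def dimat_one_def)
qed

text \<open>The inverse of \<open>N(a)\<close> is \<open>M(-a)\<close>, so inverting both sides turns the claim into an exchange of whirls
  in which the order of the factors is reversed.\<close>

lemma curl_exchange:
  assumes "\<And>i. a (i mod int n) + b (i mod int n) = a' (i mod int n) + b' (i mod int n)"
    and "\<And>i. b (i mod int n) * a ((i + 1) mod int n) = a' (i mod int n) * b' ((i + 1) mod int n)"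
  shows "curl n a **\<^sub>\<int> curl n b = curl n b' **\<^sub>\<int> curl n a'"
proof -
  let ?W = "\<lambda>x. whirl n (\<lambda>i. - x i)" and ?N = "curl n"
  note assoc = dimat_mult_assoc[of _ n] and U = U_mult curl_U whirl_U
  have W: "?W b **\<^sub>\<int> ?W a = ?W a' **\<^sub>\<int> ?W b'"
  proof (rule whirl_exchange)
    fix i
    show "- b (i mod int n) + - a (i mod int n) = - b' (i mod int n) + - a' (i mod int n)"
      using assms(1)[of i] by simp
    show "- b (i mod int n) * - a ((i + 1) mod int n) = - a' (i mod int n) * - b' ((i + 1) mod int n)"
      using assms(2)[of i] by simp
  qed
  have inv: "(?N x **\<^sub>\<int> ?N y) **\<^sub>\<int> (?W y **\<^sub>\<int> ?W x) = dimat_one" for x y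
  proof -
    have "(?N x **\<^sub>\<int> ?N y) **\<^sub>\<int> (?W y **\<^sub>\<int> ?W x) = ?N x **\<^sub>\<int> ((?N y **\<^sub>\<int> ?W y) **\<^sub>\<int> ?W x)"
      by (simp add: assoc U)
    then show ?thesis by (simp add: curl_left_inverse dimat_one_mult[OF whirl_U])
  qed
  have inv': "(?W x **\<^sub>\<int> ?W y) **\<^sub>\<int> (?N y **\<^sub>\<int> ?N x) = dimat_one" for x y
  proof -
    have "(?W x **\<^sub>\<int> ?W y) **\<^sub>\<int> (?N y **\<^sub>\<int> ?N x) = ?W x **\<^sub>\<int> ((?W y **\<^sub>\<int> ?N y) **\<^sub>\<int> ?N x)"
      by (simp add: assoc U)
    then show ?thesis by (simp add: curl_right_inverse dimat_one_mult[OF curl_U])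
  qed
  have "?N a **\<^sub>\<int> ?N b = (?N a **\<^sub>\<int> ?N b) **\<^sub>\<int> ((?W a' **\<^sub>\<int> ?W b') **\<^sub>\<int> (?N b' **\<^sub>\<int> ?N a'))"
    unfolding inv' by (simp add: dimat_mult_one[of _ n] U)
  also have "\<dots> = ((?N a **\<^sub>\<int> ?N b) **\<^sub>\<int> (?W b **\<^sub>\<int> ?W a)) **\<^sub>\<int> (?N b' **\<^sub>\<int> ?N a')"
    unfolding W by (simp add: assoc U)
  also have "\<dots> = ?N b' **\<^sub>\<int> ?N a'"
    unfolding inv by (simp add: dimat_one_mult[of _ n] U)
  finally show ?thesis .
qed

text \<open>The solution of the exchange relations for parameters that are only given at the residues modulo
  \<open>n\<close>: they are extended periodically.\<close>

lemma admissible_exchange: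
  assumes n: "n \<ge> 1" and A: "admissible n A" and b: "positive n b"
    and small: "\<And>j. j \<in> {0..<int n} \<Longrightarrow> total n A \<le> b j / 2"
  shows "\<exists>B a'. (\<forall>k. positive n (B k)) \<and> admissible n a' \<and>
    (\<forall>j\<in>{0..<int n}. (\<lambda>k. B k j) \<longlonglongrightarrow> b j) \<and>
    (\<forall>k i. A k (i mod int n) + B (Suc k) (i mod int n) = a' k (i mod int n) + B k (i mod int n)) \<and>
    (\<forall>k i. A k (i mod int n) * B (Suc k) ((i + 1) mod int n) = B k (i mod int n) * a' k ((i + 1) mod int n))"
proof -
  define \<alpha> where "\<alpha> k i = A k (i mod int n)" for k i
  define \<beta> where "\<beta> i = b (i mod int n)" for i
  have mod: "i mod int n \<in> {0..<int n}" for i using n by auto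
  have mass: "mass n (\<alpha> k) = mass n (A k)" for k by (rule sum.cong) (auto simp: \<alpha>_def)
  have "\<exists>B a'. (\<forall>k i. 0 < B k i) \<and> (\<forall>k. periodic n (B k)) \<and>
    (\<forall>k i. 0 < a' k i) \<and> (\<forall>k. periodic n (a' k)) \<and> (\<forall>i. summable (\<lambda>k. a' k i)) \<and>
    (\<forall>i. (\<lambda>k. B k i) \<longlonglongrightarrow> \<beta> i) \<and> (\<forall>k i. \<alpha> k i + B (Suc k) i = a' k i + B k i) \<and>
    (\<forall>k i. \<alpha> k i * B (Suc k) (i + 1) = B k i * a' k (i + 1))"
  proof (rule scalar_exchange[OF n])
    show "total n \<alpha> \<le> \<beta> j / 2" for j
      unfolding mass \<beta>_def using small[OF mod] .
    show "summable (\<lambda>k. mass n (\<alpha> k))" unfolding mass using A by (simp add: admissible_def)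
  qed (use A b mod in \<open>auto simp: admissible_def \<alpha>_def \<beta>_def\<close>)
  then obtain B a' where B: "\<And>k i. 0 < B k i" "\<And>k. periodic n (B k)"
    and a': "\<And>k i. 0 < a' k i" "\<And>k. periodic n (a' k)" "\<And>i. summable (\<lambda>k. a' k i)"
    and lim: "\<And>i. (\<lambda>k. B k i) \<longlonglongrightarrow> \<beta> i"
    and rel: "\<And>k i. \<alpha> k i + B (Suc k) i = a' k i + B k i"
      "\<And>k i. \<alpha> k i * B (Suc k) (i + 1) = B k i * a' k (i + 1)"
    by blast
  show ?thesis
  proof (rule exI[of _ B], rule exI[of _ a'], intro conjI allI ballI)
    show "admissible n a'" unfolding admissible_def using a' by (auto intro: summable_sum)
    show "(\<lambda>k. B k j) \<longlonglongrightarrow> b j" if "j \<in> {0..<int n}" for j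
      using lim[of j] that by (simp add: \<beta>_def)
    fix k i
    show "A k (i mod int n) + B (Suc k) (i mod int n) = a' k (i mod int n) + B k (i mod int n)"
      using rel(1)[of k "i mod int n"] by (simp add: \<alpha>_def)
    show "A k (i mod int n) * B (Suc k) ((i + 1) mod int n) = B k (i mod int n) * a' k ((i + 1) mod int n)"
      using rel(2)[of k i] by (simp add: \<alpha>_def periodic_mod[OF B(2)] periodic_mod[OF a'(2)])
  qed (rule B)
qed

lemma whirl_exchange_sequence:
  assumes n: "n \<ge> 1" and A: "admissible n A" and b: "positive n b"
    and small: "\<And>j. j \<in> {0..<int n} \<Longrightarrow> total n A \<le> b j / 2"
  shows "\<exists>B a'. (\<forall>k. positive n (B k)) \<and> admissible n a' \<and>
    (\<forall>j\<in>{0..<int n}. (\<lambda>k. B k j) \<longlonglongrightarrow> b j) \<and>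
    (\<forall>k. whirl n (A k) **\<^sub>\<int> whirl n (B (Suc k)) = whirl n (B k) **\<^sub>\<int> whirl n (a' k))"
proof -
  obtain B a' where *: "\<forall>k. positive n (B k)" "admissible n a'"
      "\<forall>j\<in>{0..<int n}. (\<lambda>k. B k j) \<longlonglongrightarrow> b j"
    and rel: "\<And>k i. A k (i mod int n) + B (Suc k) (i mod int n) = a' k (i mod int n) + B k (i mod int n)"
      "\<And>k i. A k (i mod int n) * B (Suc k) ((i + 1) mod int n) = B k (i mod int n) * a' k ((i + 1) mod int n)"
    using admissible_exchange[of n A b, OF n A b small] by blast
  have "whirl n (A k) **\<^sub>\<int> whirl n (B (Suc k)) = whirl n (B k) **\<^sub>\<int> whirl n (a' k)" for k
    by (rule whirl_exchange) (rule rel)+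
  then show ?thesis using * by blast
qed

text \<open>The parameters of the reflected whirl or curl, see \<open>reflect_whirl\<close> and \<open>reflect_curl\<close>. Entry
  \<open>(i, i + 1)\<close> of the reflection is entry \<open>(-i-1, -i)\<close> of the original matrix.\<close>

definition reflect_params :: "nat \<Rightarrow> (int \<Rightarrow> real) \<Rightarrow> int \<Rightarrow> real" where
  "reflect_params n a = (\<lambda>i. a ((- i - 1) mod int n))"

lemma reflect_params_mod: "reflect_params n a (k mod int n) = a ((- k - 1) mod int n)"
proof -
  have "(- (k mod int n) - 1) mod int n = (- k - 1) mod int n"
    by (metis mod_diff_left_eq mod_minus_eq)
  then show ?thesis by (simp add: reflect_params_def)
qed

lemma reflect_params_involution:
  "reflect_params n (reflect_params n a) i = a (i mod int n)"
  using reflect_params_mod[of n a "- i - 1"] by (simp add: reflect_params_def)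

lemma positive_reflect_params: "n \<ge> 1 \<Longrightarrow> positive n a \<Longrightarrow> positive n (reflect_params n a)"
  by (simp add: reflect_params_def)

lemma mass_reflect_params:
  assumes "n \<ge> 1"
  shows "mass n (reflect_params n a) = mass n a"
proof -
  have inv: "(- ((- i - 1) mod int n) - 1) mod int n = i mod int n" for i
  proof -
    have "(- ((- i - 1) mod int n) - 1) mod int n = (- (- i - 1) - 1) mod int n"
      by (metis mod_diff_left_eq mod_minus_eq)
    then show ?thesis by simp
  qed
  show ?thesis
    by (rule sum.reindex_bij_witness[of _ "\<lambda>i. (- i - 1) mod int n" "\<lambda>i. (- i - 1) mod int n"])
       (use assms inv in \<open>auto simp: reflect_params_def\<close>)
qed

lemma admissible_reflect_params:
  "n \<ge> 1 \<Longrightarrow> admissible n a \<Longrightarrow> admissible n (\<lambda>k. reflect_params n (a k))"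
  by (simp add: admissible_def mass_reflect_params positive_reflect_params)

text \<open>The relations required by \<open>curl_exchange\<close> differ from those for whirls in that the index shift
  sits on the other factor of each product; reversing the order of the indices turns one system into
  the other.\<close>

lemma curl_exchange_sequence:
  assumes n: "n \<ge> 1" and A: "admissible n A" and b: "positive n b"
    and small: "\<And>j. j \<in> {0..<int n} \<Longrightarrow> total n A \<le> b j / 2"
  shows "\<exists>B a'. (\<forall>k. positive n (B k)) \<and> admissible n a' \<and>
    (\<forall>j\<in>{0..<int n}. (\<lambda>k. B k j) \<longlonglongrightarrow> b j) \<and>
    (\<forall>k. curl n (A k) **\<^sub>\<int> curl n (B (Suc k)) = curl n (B k) **\<^sub>\<int> curl n (a' k))"
proof -
  let ?r = "reflect_params n"
  have mod: "i mod int n \<in> {0..<int n}" for i using n by auto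
  have "total n (\<lambda>k. ?r (A k)) \<le> ?r b j / 2" for j
    using small[OF mod, of "- j - 1"] by (simp add: mass_reflect_params[OF n]) (simp add: reflect_params_def)
  then obtain B a' where B: "\<forall>k. positive n (B k)" and a': "admissible n a'"
    and lim: "\<And>j. j\<in>{0..<int n} \<Longrightarrow> (\<lambda>k. B k j) \<longlonglongrightarrow> ?r b j"
    and rel: "\<And>k i. ?r (A k) (i mod int n) + B (Suc k) (i mod int n) = a' k (i mod int n) + B k (i mod int n)"
      "\<And>k i. ?r (A k) (i mod int n) * B (Suc k) ((i + 1) mod int n) = B k (i mod int n) * a' k ((i + 1) mod int n)"
    using admissible_exchange[of n "\<lambda>k. ?r (A k)" "?r b", OF n admissible_reflect_params[OF n A]
        positive_reflect_params[OF n b]] by blast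
  have "curl n (A k) **\<^sub>\<int> curl n (?r (B (Suc k))) = curl n (?r (B k)) **\<^sub>\<int> curl n (?r (a' k))" for k
  proof (rule curl_exchange)
    fix i
    show "A k (i mod int n) + ?r (B (Suc k)) (i mod int n) = ?r (a' k) (i mod int n) + ?r (B k) (i mod int n)"
      using rel(1)[of k "- i - 1"] by (simp add: reflect_params_mod)
    have idx: "- i - 2 + 1 = - i - 1" "- (- i - 2) - 1 = i + 1" "- (i + 1) - 1 = - i - 2"
      by simp_all
    show "?r (B (Suc k)) (i mod int n) * A k ((i + 1) mod int n) =
      ?r (a' k) (i mod int n) * ?r (B k) ((i + 1) mod int n)"
      using rel(2)[of k "- i - 2"] by (simp only: reflect_params_mod idx mult.commute)
  qed
  moreover have "(\<lambda>k. ?r (B k) j) \<longlonglongrightarrow> b j" if "j \<in> {0..<int n}" for j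
  proof -
    have "(\<lambda>k. ?r (B k) j) \<longlonglongrightarrow> ?r (?r b) j"
      using lim[OF mod, of "- j - 1"] by (simp only: reflect_params_def[of n "B _"] reflect_params_def[of n "?r b"])
    then show ?thesis using that by (simp add: reflect_params_involution)
  qed
  moreover have "\<forall>k. positive n (?r (B k))" using positive_reflect_params[OF n] B by blast
  ultimately show ?thesis
    using admissible_reflect_params[OF n a']
    by - (rule exI[of _ "\<lambda>k. ?r (B k)"], rule exI[of _ "\<lambda>k. ?r (a' k)"], blast)
qed

lemma whirl_family: "n \<ge> 1 \<Longrightarrow> factor_family n (whirl n)"
proof (unfold_locales, goal_cases)
  case (4 A a)
  then show ?case by (auto simp: dimat_lim_def whirl_def)
next
  case (5 A b)
  then show ?case by (rule whirl_exchange_sequence)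
qed (simp_all add: whirl_U whirl_dominated, simp add: whirl_def)

lemma curl_family: "n \<ge> 1 \<Longrightarrow> factor_family n (curl n)"
proof (unfold_locales, goal_cases)
  case (2 a i)
  have "{i..<i + 1} = {i}" by auto
  then show ?case by (simp add: curl_def)
next
  case (4 A a)
  then show ?case by (auto simp: dimat_lim_def curl_def intro!: tendsto_prod)
next
  case (5 A b)
  then show ?case by (rule curl_exchange_sequence)
qed (auto simp: curl_U curl_dominated)

section \<open>Left-infinite products by reflection\<close>

lemma RC_right_limit_semigroup: "n \<ge> 1 \<Longrightarrow> right_limit_semigroup n (RC n)"
  using factor_family.RP_right_limit_semigroup[OF curl_family]
  by (simp add: RC_def factor_family.RP_def[OF curl_family])

lemma RW_right_limit_semigroup: "n \<ge> 1 \<Longrightarrow> right_limit_semigroup n (RW n)"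
  using factor_family.RP_right_limit_semigroup[OF whirl_family]
  by (simp add: RW_def factor_family.RP_def[OF whirl_family])

definition reflect :: "dimat \<Rightarrow> dimat" where
  "reflect X = (\<lambda>i j. X (- j) (- i))"

lemma reflect_reflect [simp]: "reflect (reflect X) = X"
  by (simp add: reflect_def)

lemma reflect_one [simp]: "reflect dimat_one = dimat_one"
  by (auto simp: reflect_def dimat_one_def fun_eq_iff)

lemma reflect_U: "X \<in> U n \<Longrightarrow> reflect X \<in> U n"
proof -
  assume X: "X \<in> U n"
  have "X (- (j + int n)) (- (i + int n)) = X (- j) (- i)" for i j
  proof -
    have "X (- (j + int n) + int n) (- (i + int n) + int n) = X (- (j + int n)) (- (i + int n))"
      using X by (auto simp only: U_def mem_Collect_eq)
    then show ?thesis by simp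
  qed
  then show ?thesis using X by (simp add: U_def reflect_def)
qed

lemma reflect_mult:
  assumes X: "X \<in> U n" and Y: "Y \<in> U n"
  shows "reflect (X **\<^sub>\<int> Y) = reflect Y **\<^sub>\<int> reflect X"
proof (intro ext)
  fix i j
  show "reflect (X **\<^sub>\<int> Y) i j = (reflect Y **\<^sub>\<int> reflect X) i j"
    unfolding dimat_mult_U[OF reflect_U[OF Y] reflect_U[OF X]]
    unfolding reflect_def dimat_mult_U[OF X Y]
    by (rule sum.reindex_bij_witness[of _ uminus uminus]) auto
qed

lemma left_partial_U: "(\<And>k. X k \<in> U n) \<Longrightarrow> left_partial X k \<in> U n"
  by (induction k) (auto simp: U_one U_mult)

lemma reflect_left_partial:
  assumes "\<And>k. X k \<in> U n"
  shows "reflect (left_partial X k) = right_partial (\<lambda>i. reflect (X i)) k"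
  by (induction k) (simp_all add: reflect_mult[OF assms left_partial_U[of X, OF assms]])

lemma dimat_lim_reflect: "dimat_lim (\<lambda>k. reflect (P k)) (reflect X) \<longleftrightarrow> dimat_lim P X"
proof -
  have *: "dimat_lim (\<lambda>k. reflect (P k)) (reflect X)" if "dimat_lim P X" for P X
    using that by (simp add: dimat_lim_def reflect_def)
  show ?thesis using *[of P X] *[of "\<lambda>k. reflect (P k)" "reflect X"] by auto
qed

lemma has_left_prod_reflect:
  assumes "\<And>k. X k \<in> U n"
  shows "has_left_prod X L \<longleftrightarrow> has_right_prod (\<lambda>i. reflect (X i)) (reflect L)"
proof -
  have "right_partial (\<lambda>i. reflect (X i)) = (\<lambda>k. reflect (left_partial X k))"
    by (simp add: reflect_left_partial[OF assms] fun_eq_iff)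
  then show ?thesis
    unfolding has_left_prod_def has_right_prod_def by (simp add: dimat_lim_reflect)
qed

text \<open>Reflection reverses the order of multiplication and is continuous, so it carries left-infinite
  products to right-infinite ones.\<close>

lemma left_limit_semigroup_reflect:
  assumes S: "right_limit_semigroup n S" and T: "\<And>X. X \<in> T \<longleftrightarrow> reflect X \<in> S"
  shows "left_limit_semigroup n T"
proof -
  have TU: "X \<in> U n" if "X \<in> T" for X
  proof -
    have "reflect X \<in> U n" using S T that by (auto simp: right_limit_semigroup_def subsemigroup_U_def)
    then show ?thesis using reflect_U by fastforce
  qed
  have "X **\<^sub>\<int> Y \<in> T" if "X \<in> T" "Y \<in> T" for X Y
    using S that by (simp add: T reflect_mult[OF TU TU, OF that] right_limit_semigroup_def subsemigroup_U_def)
  moreover have "L \<in> T" if X: "\<And>k. X k \<in> T" and L: "has_left_prod X L" for X L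
  proof -
    have "has_right_prod (\<lambda>i. reflect (X i)) (reflect L)"
      using L has_left_prod_reflect[of X n, OF TU[OF X]] by simp
    moreover have "\<forall>k. reflect (X k) \<in> S" using X T by simp
    ultimately show ?thesis using S unfolding T right_limit_semigroup_def by metis
  qed
  ultimately show ?thesis using TU by (auto simp: left_limit_semigroup_def subsemigroup_U_def)
qed

lemma reflect_whirl: "reflect (whirl n a) = whirl n (reflect_params n a)"
proof (intro ext)
  fix i j :: int
  have "- j = - i - 1" if "j = i + 1" using that by simp
  then show "reflect (whirl n a) i j = whirl n (reflect_params n a) i j"
    by (auto simp: reflect_def whirl_def reflect_params_mod)
qed

lemma reflect_curl: "reflect (curl n a) = curl n (reflect_params n a)"
proof (intro ext)
  fix i j :: int
  have "(\<Prod>k\<in>{- j..<- i}. a (k mod int n)) = (\<Prod>k\<in>{i..<j}. a ((- k - 1) mod int n))"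
    by (rule prod.reindex_bij_witness[of _ "\<lambda>k. - k - 1" "\<lambda>k. - k - 1"]) auto
  then show "reflect (curl n a) i j = curl n (reflect_params n a) i j"
    by (auto simp: reflect_def curl_def reflect_params_mod)
qed

lemma left_products_reflect:
  assumes n: "n \<ge> 1" and U: "\<And>a. F a \<in> U n"
    and F: "\<And>a. reflect (F a) = F (reflect_params n a)"
  shows "(\<exists>a. admissible n a \<and> has_left_prod (\<lambda>i. F (a i)) X) \<longleftrightarrow>
    (\<exists>a. admissible n a \<and> has_right_prod (\<lambda>i. F (a i)) (reflect X))"
proof
  assume "\<exists>a. admissible n a \<and> has_left_prod (\<lambda>i. F (a i)) X"
  then obtain a where a: "admissible n a" "has_left_prod (\<lambda>i. F (a i)) X" by blast
  have "has_right_prod (\<lambda>i. F (reflect_params n (a i))) (reflect X)"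
    using a(2) has_left_prod_reflect[of "\<lambda>i. F (a i)", OF U] by (simp add: F)
  then show "\<exists>a. admissible n a \<and> has_right_prod (\<lambda>i. F (a i)) (reflect X)"
    using admissible_reflect_params[OF n a(1)] by blast
next
  assume "\<exists>a. admissible n a \<and> has_right_prod (\<lambda>i. F (a i)) (reflect X)"
  then obtain a where a: "admissible n a" "has_right_prod (\<lambda>i. F (a i)) (reflect X)" by blast
  have "F (a i) = reflect (F (reflect_params n (a i)))" for i by (metis F reflect_reflect)
  then have "has_left_prod (\<lambda>i. F (reflect_params n (a i))) X"
    using a(2) has_left_prod_reflect[of "\<lambda>i. F (reflect_params n (a i))", OF U] by simp
  then show "\<exists>a. admissible n a \<and> has_left_prod (\<lambda>i. F (a i)) X"
    using admissible_reflect_params[OF n a(1)] by blast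
qed

theorem theorem9p5:
  fixes n :: nat
  assumes "n \<ge> 1"
  shows "right_limit_semigroup n (RC n) \<and> right_limit_semigroup n (RW n) \<and>
         left_limit_semigroup n (LC n) \<and> left_limit_semigroup n (LW n)"
proof (intro conjI)
  show R: "right_limit_semigroup n (RC n)" "right_limit_semigroup n (RW n)"
    using assms by (rule RC_right_limit_semigroup, rule RW_right_limit_semigroup)
  show "left_limit_semigroup n (LC n)"
    using R(1) by (rule left_limit_semigroup_reflect)
      (simp add: LC_def RC_def left_products_reflect[of n "curl n", OF assms curl_U reflect_curl])
  show "left_limit_semigroup n (LW n)"
    using R(2) by (rule left_limit_semigroup_reflect)
      (simp add: LW_def RW_def left_products_reflect[of n "whirl n", OF assms whirl_U reflect_whirl])
qed

end
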